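(* Let $F$ be a Hermitian, matrix-valued nc function in the noncommuting variables $x=(x_1,\dots,x_g)$ that is both matrix convex and real entire near the origin, and let $F(x)=\sum_iF_i(x)$ be its nc power series. Then $$F(X)=F_0(X)+F_1(X)+F_2(X)$$ for all $X\in\mathbb{H}(\mathbb{C})^g$, where each $F_i$ is a matrix-valued nc polynomial of degree $i$ in $x$ (i.e. homogeneous of degree $i$, possibly zero).
   Context: **NC polynomials.** For noncommuting variables $x=(x_1,\dots,x_g)$, $\mathbb{C}\langle x\rangle$ denotes the ring of noncommutative (nc) polynomials, i.e. finite linear combinations of words in the $x_i$. The involution $*$ on $\mathbb{C}\langle x\rangle$ is determined by $x_i^*=x_i$, $(pq)^*=q^*p^*$, $(\lambda p)^*=\overline{\lambda}p^*$. A matrix-valued nc polynomial is a matrix $P=(p_{ij})$ with entries in $\mathbb{C}\langle x\rangle$; it is Hermitian if $P^*=P$, where $(P^* )_{ij}=p_{ji}^*$. Polynomials are evaluated at tuples $X$ of $n\times n$ Hermitian matrices by substituting $X_i$ for $x_i$ (the constant $1$ becomes $I_n$), and matrix-valued polynomials are evaluated entrywise, giving block matrices. **NC sets and functions.** $\mathbb{H}(\mathbb{C}^{n\times n})^g$ is the set of $g$-tuples of $n\times n$ Hermitian matrices, and $\mathbb{H}(\mathbb{C})^g=\bigcup_{n\ge1}\mathbb{H}(\mathbb{C}^{n\times n})^g$. An nc set is a subset $D\subset\mathbb{H}(\mathbb{C})^g$ closed under direct sums (coordinatewise) and under unitary equivalence $X\mapsto U^*XU=(U^*X_1U,\dots,U^*X_gU)$.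 An nc function $f$ on $D$ assigns to each $X\in D$ of size $n$ an $n\times n$ complex matrix $f(X)$, with $f(X\oplus\tilde X)=f(X)\oplus f(\tilde X)$ and $f(U^*XU)=U^*f(X)U$ for unitary $U$. A matrix-valued nc function is a matrix $F=(F_{ij})$ of nc functions. The norm of a tuple is $\|X\|=$ the maximum eigenvalue of $(\sum_i X_iX_i^* )^{1/2}$. **Power series, Hermitian.** An nc power series is a formal sum $\sum_{i\ge0}F_i(x)$ with each $F_i$ a matrix-valued nc polynomial homogeneous of degree $i$. A matrix-valued nc function $F$ with such a power series is Hermitian if each $F_i$ is a Hermitian matrix-valued polynomial. **Real entire near the origin.** A matrix-valued nc function $F$ is real entire near the origin if: (1) there are $\varepsilon>0$ and an nc power series $\sum_iF_i(x)$ such that for every $n$ the series $F(X)=\sum_iF_i(X)$ converges for all $X\in\mathbb{H}(\mathbb{C}^{n\times n})^g$ with $\|X\|<\varepsilon$; and (2) for every $n$ the analytic function $X\mapsto F(X)$ on this ball continues analytically, as a function of $gn^2$ complex variables, to an open subset of $(\mathbb{C}^{n\times n})^g$ containing $\mathbb{H}(\mathbb{C}^{n\times n})^g$. For Hermitian $X$ outside the ball, $F(X)$ denotes the value of this continuation. **Matrix convex near the origin.** $F$ is matrix convex near the origin if $F$ is Hermitian and there is $\varepsilon>0$ such that for every $n$, all $X,Y\in\mathbb{H}(\mathbb{C}^{n\times n})^g$ with $\|X\|,\|Y\|<\varepsilon$, and all $t\in[0,1]$, $$F(tX+(1-t)Y)\preceq tF(X)+(1-t)F(Y),$$ where $\preceq$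 is the Loewner (positive semidefinite) order. *)

theory Defs
  imports
    "HOL-Analysis.Infinite_Sum"
    "HOL-Library.Poly_Mapping"
    "Jordan_Normal_Form.Schur_Decomposition"
    "Jordan_Normal_Form.Spectral_Radius"
begin

text \<open>
  The nc variables are indexed by a finite (hence nonempty) type \<open>'g\<close>. A tuple of matrices is a
  function \<open>'g \<Rightarrow> complex mat\<close>; the size \<open>n \<ge> 1\<close> of its entries varies and is carried explicitly.
\<close>

type_synonym 'g tuple = "'g \<Rightarrow> complex mat"

definition mat_tuples :: "nat \<Rightarrow> 'g tuple set" where
  "mat_tuples n = {X. \<forall>i. X i \<in> carrier_mat n n}"

definition herm_tuples :: "nat \<Rightarrow> 'g tuple set" where
  "herm_tuples n = {X \<in> mat_tuples n. \<forall>i. mat_adjoint (X i) = X i}"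


section \<open>Positivity and the norm of a tuple\<close>

definition psd :: "complex mat \<Rightarrow> bool" where
  "psd A \<longleftrightarrow> A \<in> carrier_mat (dim_row A) (dim_row A) \<and> mat_adjoint A = A \<and>
     (\<forall>v \<in> carrier_vec (dim_row A). 0 \<le> Re ((A *\<^sub>v v) \<bullet>c v))"

definition loewner_le :: "complex mat \<Rightarrow> complex mat \<Rightarrow> bool" where
  "loewner_le A B \<longleftrightarrow> psd (B - A)"

text \<open>A positive semidefinite matrix has exactly one positive semidefinite square root, so for such
  a matrix the choice below is not arbitrary.\<close>

definition psd_sqrt :: "complex mat \<Rightarrow> complex mat" where
  "psd_sqrt A = (SOME B. psd B \<and> B * B = A)"

definition max_eigenvalue :: "complex mat \<Rightarrow> real" where
  "max_eigenvalue A = Max {r :: real. eigenvalue A (complex_of_real r)}"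

definition sum_squares_mat :: "nat \<Rightarrow> ('g :: finite) tuple \<Rightarrow> complex mat" where
  "sum_squares_mat n X = mat n n (\<lambda>(a, b). \<Sum>i \<in> UNIV. (X i * mat_adjoint (X i)) $$ (a, b))"

definition tuple_norm :: "nat \<Rightarrow> ('g :: finite) tuple \<Rightarrow> real" where
  "tuple_norm n X = max_eigenvalue (psd_sqrt (sum_squares_mat n X))"

definition herm_ball :: "nat \<Rightarrow> real \<Rightarrow> ('g :: finite) tuple set" where
  "herm_ball n \<epsilon> = {X \<in> herm_tuples n. tuple_norm n X < \<epsilon>}"


section \<open>Block matrices\<close>

text \<open>Flattens a matrix of \<open>n \<times> n\<close> blocks.\<close>

definition block_mat :: "nat \<Rightarrow> complex mat mat \<Rightarrow> complex mat" where
  "block_mat n M = mat (dim_row M * n) (dim_col M * n)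
     (\<lambda>(r, s). (M $$ (r div n, s div n)) $$ (r mod n, s mod n))"


section \<open>NC polynomials\<close>

text \<open>An nc polynomial is a finitely supported family of coefficients indexed by words.\<close>

type_synonym 'g ncpoly = "'g list \<Rightarrow>\<^sub>0 complex"

text \<open>The involution reverses words and conjugates coefficients.\<close>

lift_definition nc_star :: "'g ncpoly \<Rightarrow> 'g ncpoly" is "\<lambda>c w. cnj (c (rev w))"
proof -
  fix c :: "'g list \<Rightarrow> complex"
  assume "finite {w. c w \<noteq> 0}"
  then have "finite (rev ` {w. c w \<noteq> 0})" by simp
  moreover have "{w. cnj (c (rev w)) \<noteq> 0} \<subseteq> rev ` {w. c w \<noteq> 0}"
    by (auto intro: rev_image_eqI[of "rev _"])
  ultimately show "finite {w. cnj (c (rev w)) \<noteq> 0}" by (rule finite_subset[rotated])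
qed

definition word_eval :: "nat \<Rightarrow> 'g tuple \<Rightarrow> 'g list \<Rightarrow> complex mat" where
  "word_eval n X w = foldr (\<lambda>i A. X i * A) w (1\<^sub>m n)"

definition nc_eval :: "nat \<Rightarrow> 'g tuple \<Rightarrow> 'g ncpoly \<Rightarrow> complex mat" where
  "nc_eval n X p = mat n n (\<lambda>(a, b).
     \<Sum>w \<in> Poly_Mapping.keys p. Poly_Mapping.lookup p w * word_eval n X w $$ (a, b))"

definition mat_nc_star :: "'g ncpoly mat \<Rightarrow> 'g ncpoly mat" where
  "mat_nc_star P = mat (dim_col P) (dim_row P) (\<lambda>(i, j). nc_star (P $$ (j, i)))"

definition hermitian_poly :: "'g ncpoly mat \<Rightarrow> bool" where
  "hermitian_poly P \<longleftrightarrow> mat_nc_star P = P"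

text \<open>The zero polynomial counts as homogeneous of every degree.\<close>

definition homogeneous_poly :: "nat \<Rightarrow> nat \<Rightarrow> 'g ncpoly mat \<Rightarrow> bool" where
  "homogeneous_poly m d P \<longleftrightarrow> P \<in> carrier_mat m m \<and>
     (\<forall>i<m. \<forall>j<m. \<forall>w \<in> Poly_Mapping.keys (P $$ (i, j)). length w = d)"

definition poly_eval :: "nat \<Rightarrow> 'g ncpoly mat \<Rightarrow> 'g tuple \<Rightarrow> complex mat" where
  "poly_eval n P X = block_mat n (map_mat (nc_eval n X) P)"


section \<open>NC sets and nc functions\<close>

definition mat_dsum :: "complex mat \<Rightarrow> complex mat \<Rightarrow> complex mat" where
  "mat_dsum A B =
     four_block_mat A (0\<^sub>m (dim_row A) (dim_col B)) (0\<^sub>m (dim_row B) (dim_col A)) B"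

definition tuple_dsum :: "'g tuple \<Rightarrow> 'g tuple \<Rightarrow> 'g tuple" where
  "tuple_dsum X Y = (\<lambda>i. mat_dsum (X i) (Y i))"

definition unitary_mat :: "nat \<Rightarrow> complex mat \<Rightarrow> bool" where
  "unitary_mat n U \<longleftrightarrow> U \<in> carrier_mat n n \<and> mat_adjoint U * U = 1\<^sub>m n"

definition tuple_conj :: "complex mat \<Rightarrow> 'g tuple \<Rightarrow> 'g tuple" where
  "tuple_conj U X = (\<lambda>i. mat_adjoint U * X i * U)"

definition nc_set :: "'g tuple set \<Rightarrow> bool" where
  "nc_set D \<longleftrightarrow> D \<subseteq> (\<Union>n \<in> {1..}. herm_tuples n) \<and>
     (\<forall>X \<in> D. \<forall>Y \<in> D. tuple_dsum X Y \<in> D) \<and>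
     (\<forall>n \<ge> 1. \<forall>X \<in> D \<inter> herm_tuples n. \<forall>U. unitary_mat n U \<longrightarrow> tuple_conj U X \<in> D)"

definition nc_function :: "'g tuple set \<Rightarrow> ('g tuple \<Rightarrow> complex mat) \<Rightarrow> bool" where
  "nc_function D f \<longleftrightarrow>
     (\<forall>n \<ge> 1. \<forall>X \<in> D \<inter> herm_tuples n. f X \<in> carrier_mat n n) \<and>
     (\<forall>X \<in> D. \<forall>Y \<in> D. f (tuple_dsum X Y) = mat_dsum (f X) (f Y)) \<and>
     (\<forall>n \<ge> 1. \<forall>X \<in> D \<inter> herm_tuples n. \<forall>U. unitary_mat n U \<longrightarrow>
        f (tuple_conj U X) = mat_adjoint U * f X * U)"

type_synonym 'g matfun = "('g tuple \<Rightarrow> complex mat) mat"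

definition matrix_nc_function :: "nat \<Rightarrow> 'g tuple set \<Rightarrow> 'g matfun \<Rightarrow> bool" where
  "matrix_nc_function m D F \<longleftrightarrow> F \<in> carrier_mat m m \<and> (\<forall>i<m. \<forall>j<m. nc_function D (F $$ (i, j)))"

definition fun_eval :: "nat \<Rightarrow> 'g matfun \<Rightarrow> 'g tuple \<Rightarrow> complex mat" where
  "fun_eval n F X = block_mat n (map_mat (\<lambda>f. f X) F)"


section \<open>Power series and Hermitian functions\<close>

definition mat_sums :: "(nat \<Rightarrow> complex mat) \<Rightarrow> complex mat \<Rightarrow> bool" where
  "mat_sums A S \<longleftrightarrow> (\<forall>r < dim_row S. \<forall>s < dim_col S. (\<lambda>k. A k $$ (r, s)) sums (S $$ (r, s)))"

text \<open>\<open>F\<close> is given on the ball of radius \<open>\<epsilon>\<close>, the same for all sizes, by the nc power series whose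
  homogeneous component of degree \<open>k\<close> is \<open>Fs k\<close>.\<close>

definition has_nc_power_series ::
  "nat \<Rightarrow> ('g :: finite) tuple set \<Rightarrow> 'g matfun \<Rightarrow> (nat \<Rightarrow> 'g ncpoly mat) \<Rightarrow> real \<Rightarrow> bool" where
  "has_nc_power_series m D F Fs \<epsilon> \<longleftrightarrow> (\<forall>k. homogeneous_poly m k (Fs k)) \<and>
     (\<forall>n \<ge> 1. \<forall>X \<in> herm_ball n \<epsilon>. X \<in> D \<and> mat_sums (\<lambda>k. poly_eval n (Fs k) X) (fun_eval n F X))"

definition hermitian_nc_function ::
  "nat \<Rightarrow> ('g :: finite) tuple set \<Rightarrow> 'g matfun \<Rightarrow> (nat \<Rightarrow> 'g ncpoly mat) \<Rightarrow> bool" where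
  "hermitian_nc_function m D F Fs \<longleftrightarrow>
     (\<exists>\<epsilon>>0. has_nc_power_series m D F Fs \<epsilon>) \<and> (\<forall>k. hermitian_poly (Fs k))"


section \<open>Analytic functions of the matrix entries\<close>

definition coords :: "nat \<Rightarrow> ('g \<times> nat \<times> nat) set" where
  "coords n = UNIV \<times> {..<n} \<times> {..<n}"

definition coord :: "'g tuple \<Rightarrow> 'g \<times> nat \<times> nat \<Rightarrow> complex" where
  "coord Z = (\<lambda>(i, a, b). Z i $$ (a, b))"

definition polydisc :: "nat \<Rightarrow> 'g tuple \<Rightarrow> real \<Rightarrow> 'g tuple set" where
  "polydisc n Z r = {W \<in> mat_tuples n. \<forall>k \<in> coords n. cmod (coord W k - coord Z k) < r}"

definition open_tuples :: "nat \<Rightarrow> 'g tuple set \<Rightarrow> bool" where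
  "open_tuples n U \<longleftrightarrow> U \<subseteq> mat_tuples n \<and> (\<forall>Z \<in> U. \<exists>r>0. polydisc n Z r \<subseteq> U)"

text \<open>Local expansion into an unconditionally convergent power series in the matrix entries. The
  multi-indices are the functions \<open>\<alpha>\<close> from \<open>coords n\<close> to the naturals.\<close>

definition analytic_at ::
  "nat \<Rightarrow> (('g :: finite) tuple \<Rightarrow> complex) \<Rightarrow> 'g tuple \<Rightarrow> bool" where
  "analytic_at n f Z \<longleftrightarrow> (\<exists>r>0. \<exists>c :: ('g \<times> nat \<times> nat \<Rightarrow> nat) \<Rightarrow> complex. \<forall>W \<in> polydisc n Z r.
     ((\<lambda>\<alpha>. c \<alpha> * (\<Prod>k \<in> coords n. (coord W k - coord Z k) ^ \<alpha> k)) has_sum f W)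
       (coords n \<rightarrow>\<^sub>E UNIV))"

definition mat_analytic_on ::
  "nat \<Rightarrow> (('g :: finite) tuple \<Rightarrow> complex mat) \<Rightarrow> 'g tuple set \<Rightarrow> bool" where
  "mat_analytic_on n f U \<longleftrightarrow> (\<forall>Z \<in> U. f Z \<in> carrier_mat n n) \<and>
     (\<forall>a<n. \<forall>b<n. \<forall>Z \<in> U. analytic_at n (\<lambda>W. f W $$ (a, b)) Z)"


section \<open>Real entire and matrix convex functions\<close>

text \<open>\<open>Fc\<close> is the analytic continuation of \<open>F\<close>: for each size \<open>n\<close> it is analytic on an open
  neighbourhood of the Hermitian tuples, and it agrees with \<open>F\<close> on the ball where the power series
  is assumed to converge. At Hermitian tuples its values are uniquely determined, and they are what
  \<open>F(X)\<close> denotes beyond that ball; nothing is assumed about the values of \<open>F\<close> itself there.\<close>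

definition real_entire_near_origin ::
  "nat \<Rightarrow> ('g :: finite) tuple set \<Rightarrow> 'g matfun \<Rightarrow> (nat \<Rightarrow> 'g ncpoly mat) \<Rightarrow> 'g matfun \<Rightarrow> bool"
where
  "real_entire_near_origin m D F Fs Fc \<longleftrightarrow> Fc \<in> carrier_mat m m \<and>
     (\<exists>\<epsilon>>0. has_nc_power_series m D F Fs \<epsilon> \<and>
       (\<forall>n \<ge> 1. \<exists>U. open_tuples n U \<and> herm_tuples n \<subseteq> U \<and>
          (\<forall>i<m. \<forall>j<m. mat_analytic_on n (Fc $$ (i, j)) U) \<and>
          (\<forall>X \<in> herm_ball n \<epsilon>. fun_eval n Fc X = fun_eval n F X)))"

definition tuple_convex_comb :: "real \<Rightarrow> 'g tuple \<Rightarrow> 'g tuple \<Rightarrow> 'g tuple" where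
  "tuple_convex_comb t X Y =
     (\<lambda>i. complex_of_real t \<cdot>\<^sub>m X i + complex_of_real (1 - t) \<cdot>\<^sub>m Y i)"

definition matrix_convex_near_origin ::
  "nat \<Rightarrow> ('g :: finite) tuple set \<Rightarrow> 'g matfun \<Rightarrow> (nat \<Rightarrow> 'g ncpoly mat) \<Rightarrow> bool" where
  "matrix_convex_near_origin m D F Fs \<longleftrightarrow> hermitian_nc_function m D F Fs \<and>
     (\<exists>\<epsilon>>0. \<forall>n \<ge> 1. herm_ball n \<epsilon> \<subseteq> D \<and>
        (\<forall>X \<in> herm_ball n \<epsilon>. \<forall>Y \<in> herm_ball n \<epsilon>. \<forall>t \<in> {0..1}.
           loewner_le (fun_eval n F (tuple_convex_comb t X Y))
             (complex_of_real t \<cdot>\<^sub>m fun_eval n F X +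
              complex_of_real (1 - t) \<cdot>\<^sub>m fun_eval n F Y)))"

end

theory Submission
  imports Defs "HOL-Complex_Analysis.Conformal_Mappings"
begin

text \<open>
  Let \<open>X\<close> be Hermitian and \<open>\<eta>\<close> a vector. Since \<open>F\<^sub>k (X \<otimes> T) = F\<^sub>k X \<otimes> T ^ k\<close>, the scalar series with
  coefficients \<open>a\<^sub>k = \<langle>F\<^sub>k X \<eta>, \<eta>\<rangle>\<close> is a matrix convex function of one variable \<open>T\<close> near 0. Convexity at
  small multiples of the adjacency matrix of a path, compared with the path having its first vertex
  cut off, shows that the Hankel form \<open>(a\<^bsub>i + j + 2\<^esub>)\<close> is positive semidefinite. In particular the even
  coefficients from degree 2 on are nonnegative and log-convex, so their series has a finite radius
  of convergence unless \<open>a\<^sub>4 = 0\<close>. On the other hand \<open>t \<mapsto> \<langle>F (t X) \<eta>, \<eta>\<rangle>\<close> continues holomorphically to a neighbourhood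
  of the real line, and a series with nonnegative coefficients cannot be continued beyond its radius
  of convergence along the positive axis (Pringsheim). Hence \<open>a\<^sub>4 = 0\<close>, and the Hankel minors
  \<open>a\<^bsub>j + 3\<^esub>\<^sup>2 \<le> a\<^sub>4 a\<^bsub>2 j + 2\<^esub>\<close> kill every coefficient of degree at least 3.
\<close>

text \<open>The obstacle is that the series and the convexity are available only at small tuples, so
  Hankel positivity has to be extracted from germs as a scale \<open>s\<close> tends to 0. Paths
  suit this because the entries of their powers count walks. Cutting node 0 off removes exactly the
  walks that visit it, and the shortest such walk from node p + 1 to node q + 1 has p + q + 2 steps
  and is unique. The first surviving coefficient is therefore a single number of degree p + q + 2.
  Visiting node 0 costs the edge to it twice, which is why degrees 0 and 1 stay free.

  Cutting off is a convex operation: the path without the edge between 0 and 1 is the midpoint of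
  the path and of its conjugate by a sign flip at node 0.

  Odd coefficients and the constant one have no known sign, so Pringsheim is applied to the even
  part without its constant term. Passing to scalars by a fixed vector loses nothing, because a
  complex quadratic form determines its matrix.\<close>

unbundle no vec_syntax

section \<open>Positive semidefinite matrices\<close>

text \<open>Vectors are plain functions, of which only the values below \<open>n\<close> matter: no
  carrier conditions arise, and product vectors for a Kronecker product can be written as
  \<open>u (r div M) * v (r mod M)\<close>.\<close>

definition quad_form :: "nat \<Rightarrow> complex mat \<Rightarrow> (nat \<Rightarrow> complex) \<Rightarrow> complex" where
  "quad_form n A v = (\<Sum>r<n. \<Sum>s<n. cnj (v r) * A $$ (r, s) * v s)"

lemma mat_adjoint_index:
  "i < dim_col A \<Longrightarrow> j < dim_row A \<Longrightarrow> mat_adjoint A $$ (i, j) = cnj (A $$ (j, i))"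
  for A :: "complex mat"
  by (simp add: mat_adjoint_def mat_of_rows_def conjugate_complex_def)

lemma mat_adjoint_carrier: "A \<in> carrier_mat n m \<Longrightarrow> mat_adjoint A \<in> carrier_mat m n"
  by (auto simp: mat_adjoint_def mat_of_rows_def)

lemma index_mult_mat_sum:
  assumes "A \<in> carrier_mat n m" "B \<in> carrier_mat m l" "i < n" "j < l"
  shows "(A * B) $$ (i, j) = (\<Sum>k<m. A $$ (i, k) * B $$ (k, j))"
  using assms by (auto simp: scalar_prod_def atLeast0LessThan intro!: sum.cong)

lemma sum_if_two_points:
  fixes f :: "nat \<Rightarrow> complex"
  assumes "a < n" "b < n"
  shows "(\<Sum>s<n. f s * ((if s = a then x else 0) + (if s = b then y else 0))) = f a * x + f b * y"
proof -
  have "(\<Sum>s<n. f s * ((if s = a then x else 0) + (if s = b then y else 0))) =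
      (\<Sum>s<n. if s = a then f s * x else 0) + (\<Sum>s<n. if s = b then f s * y else 0)"
    unfolding sum.distrib[symmetric] by (intro sum.cong) (auto simp: distrib_left)
  then show ?thesis using assms by simp
qed

text \<open>The two indicators are added, not nested, so that \<open>a = b\<close> is allowed:
  diagonal entries and the Hankel form with \<open>i = j\<close> need no case of their own.\<close>

lemma quad_form_two_points:
  assumes "a < n" "b < n"
  shows "quad_form n A (\<lambda>r. (if r = a then x else 0) + (if r = b then y else 0)) =
    cnj x * A $$ (a, a) * x + cnj x * A $$ (a, b) * y + cnj y * A $$ (b, a) * x + cnj y * A $$ (b, b) * y"
proof -
  have "quad_form n A (\<lambda>r. (if r = a then x else 0) + (if r = b then y else 0)) =
    (\<Sum>r<n. (A $$ (r, a) * x + A $$ (r, b) * y) *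
      ((if r = a then cnj x else 0) + (if r = b then cnj y else 0)))"
    unfolding quad_form_def
  proof (rule sum.cong[OF refl])
    fix r
    show "(\<Sum>s<n. cnj ((if r = a then x else 0) + (if r = b then y else 0)) * A $$ (r, s) *
        ((if s = a then x else 0) + (if s = b then y else 0))) =
      (A $$ (r, a) * x + A $$ (r, b) * y) * ((if r = a then cnj x else 0) + (if r = b then cnj y else 0))"
      unfolding sum_if_two_points[OF assms] by (simp add: algebra_simps)
  qed
  also have "\<dots> = (A $$ (a, a) * x + A $$ (a, b) * y) * cnj x + (A $$ (b, a) * x + A $$ (b, b) * y) * cnj y"
    by (rule sum_if_two_points[OF assms])
  finally show ?thesis by (simp add: algebra_simps)
qed

text \<open>Polarisation: the unit vectors kill the diagonal entries, and then (1, 1) and (1, i)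
  kill the sum and the difference of \<open>A $$ (a, b)\<close> and
  \<open>A $$ (b, a)\<close>.\<close>

lemma quad_form_zero_imp_zero:
  assumes zero: "\<And>v. quad_form n A v = 0" and ab: "a < n" "b < n"
  shows "A $$ (a, b) = 0"
proof -
  have "cnj x * A $$ (a, a) * x + cnj x * A $$ (a, b) * y + cnj y * A $$ (b, a) * x +
      cnj y * A $$ (b, b) * y = 0" for x y
    using zero quad_form_two_points[OF ab, of A x y] by simp
  from this[of 1 1] this[of 1 \<i>] this[of 1 0] this[of 0 1] show ?thesis
    by (simp add: algebra_simps complex_eq_iff)
qed

text \<open>The same four test vectors, with imaginary parts only.\<close>

lemma quad_form_real_imp_hermitian:
  assumes A: "A \<in> carrier_mat n n" and real: "\<And>v. Im (quad_form n A v) = 0"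
  shows "mat_adjoint A = A"
proof (rule eq_matI)
  fix a b assume "a < dim_row A" "b < dim_col A"
  then have ab: "a < n" "b < n" using A by auto
  have "Im (cnj x * A $$ (a, a) * x + cnj x * A $$ (a, b) * y + cnj y * A $$ (b, a) * x +
      cnj y * A $$ (b, b) * y) = 0" for x y
    unfolding quad_form_two_points[OF ab, symmetric] by (rule real)
  from this[of 1 1] this[of 1 \<i>] this[of 1 0] this[of 0 1]
  have "A $$ (a, b) = cnj (A $$ (b, a))" by (simp add: algebra_simps complex_eq_iff)
  then show "mat_adjoint A $$ (a, b) = A $$ (a, b)" using A ab by (simp add: mat_adjoint_index)
qed (use mat_adjoint_carrier[OF A] A in auto)

lemma mult_mat_vec_cscalar_prod_eq_quad_form:
  assumes "A \<in> carrier_mat n n" "v \<in> carrier_vec n"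
  shows "(A *\<^sub>v v) \<bullet>c v = quad_form n A (($) v)"
proof -
  have "(A *\<^sub>v v) $ r = (\<Sum>s<n. A $$ (r, s) * v $ s)" if "r < n" for r
    using assms that by (auto simp: scalar_prod_def atLeast0LessThan intro!: sum.cong)
  then show ?thesis using assms
    by (auto simp: scalar_prod_def quad_form_def atLeast0LessThan conjugate_complex_def sum_distrib_right
        sum_distrib_left mult_ac intro!: sum.cong)
qed

lemma quad_form_cong: "(\<And>r. r < n \<Longrightarrow> v r = w r) \<Longrightarrow> quad_form n A v = quad_form n A w"
  by (simp add: quad_form_def)

lemma quad_form_hermitian_real:
  assumes A: "A \<in> carrier_mat n n" and "mat_adjoint A = A"
  shows "Im (quad_form n A v) = 0"
proof -
  have sym: "cnj (A $$ (r, s)) = A $$ (s, r)" if "r < n" "s < n" for r s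
    using mat_adjoint_index[of s A r] assms that by simp
  have "cnj (quad_form n A v) = (\<Sum>r<n. \<Sum>s<n. cnj (v s) * A $$ (s, r) * v r)"
    unfolding quad_form_def by (auto simp: sym mult_ac intro!: sum.cong)
  also have "\<dots> = quad_form n A v" unfolding quad_form_def by (rule sum.swap)
  finally show ?thesis by (simp add: complex_eq_iff)
qed

text \<open>Reality of a complex form supplies the adjoint condition, so one clause replaces two. In
  this shape positivity passes to conjugates and to principal blocks by substituting test
  vectors.\<close>

lemma psd_iff_quad_form:
  assumes A: "A \<in> carrier_mat n n"
  shows "psd A \<longleftrightarrow> (\<forall>v. \<exists>r\<ge>0. quad_form n A v = complex_of_real r)"
proof
  assume psd: "psd A"
  show "\<forall>v. \<exists>r\<ge>0. quad_form n A v = complex_of_real r"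
  proof
    fix v
    have "quad_form n A v = quad_form n A (($) (Matrix.vec n v))" by (rule quad_form_cong) simp
    also have "\<dots> = (A *\<^sub>v Matrix.vec n v) \<bullet>c Matrix.vec n v"
      using A by (simp add: mult_mat_vec_cscalar_prod_eq_quad_form)
    finally have "0 \<le> Re (quad_form n A v)" using psd A by (auto simp: psd_def)
    moreover have "Im (quad_form n A v) = 0"
      using A psd by (intro quad_form_hermitian_real) (auto simp: psd_def)
    ultimately show "\<exists>r\<ge>0. quad_form n A v = complex_of_real r"
      by (intro exI[of _ "Re (quad_form n A v)"]) (simp add: complex_eq_iff)
  qed
next
  assume *: "\<forall>v. \<exists>r\<ge>0. quad_form n A v = complex_of_real r"
  have "Im (quad_form n A v) = 0" for v
    using spec[OF *, of v] by auto
  then have "mat_adjoint A = A" by (rule quad_form_real_imp_hermitian[OF A])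
  moreover have "0 \<le> Re ((A *\<^sub>v v) \<bullet>c v)" if "v \<in> carrier_vec n" for v
    using spec[OF *, of "($) v"] mult_mat_vec_cscalar_prod_eq_quad_form[OF A that] by auto
  ultimately show "psd A" using A by (auto simp: psd_def)
qed

lemma sum_swap_pairs:
  fixes f :: "nat \<Rightarrow> nat \<Rightarrow> nat \<Rightarrow> nat \<Rightarrow> complex"
  shows "(\<Sum>p<n. \<Sum>q<n. \<Sum>s<n. \<Sum>r<n. f p q s r) = (\<Sum>r<n. \<Sum>s<n. \<Sum>p<n. \<Sum>q<n. f p q s r)"
proof -
  have "(\<Sum>p<n. \<Sum>q<n. \<Sum>s<n. \<Sum>r<n. f p q s r) = (\<Sum>p<n. \<Sum>s<n. \<Sum>q<n. \<Sum>r<n. f p q s r)"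
    by (rule sum.cong[OF refl], rule sum.swap)
  also have "\<dots> = (\<Sum>s<n. \<Sum>p<n. \<Sum>q<n. \<Sum>r<n. f p q s r)" by (rule sum.swap)
  also have "\<dots> = (\<Sum>s<n. \<Sum>p<n. \<Sum>r<n. \<Sum>q<n. f p q s r)"
    by (rule sum.cong[OF refl], rule sum.cong[OF refl], rule sum.swap)
  also have "\<dots> = (\<Sum>s<n. \<Sum>r<n. \<Sum>p<n. \<Sum>q<n. f p q s r)"
    by (rule sum.cong[OF refl], rule sum.swap)
  also have "\<dots> = (\<Sum>r<n. \<Sum>s<n. \<Sum>p<n. \<Sum>q<n. f p q s r)" by (rule sum.swap)
  finally show ?thesis .
qed

lemma quad_form_conj:
  assumes A: "A \<in> carrier_mat n n" and U: "U \<in> carrier_mat n n"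
  shows "quad_form n (mat_adjoint U * A * U) v = quad_form n A (\<lambda>r. \<Sum>s<n. U $$ (r, s) * v s)"
proof -
  have e: "(mat_adjoint U * A * U) $$ (p, q) =
      (\<Sum>s<n. \<Sum>r<n. cnj (U $$ (r, p)) * A $$ (r, s) * U $$ (s, q))" if "p < n" "q < n" for p q
  proof -
    have c: "mat_adjoint U \<in> carrier_mat n n" by (rule mat_adjoint_carrier[OF U])
    have "(mat_adjoint U * A * U) $$ (p, q) = (\<Sum>s<n. (mat_adjoint U * A) $$ (p, s) * U $$ (s, q))"
      using index_mult_mat_sum[OF mult_carrier_mat[OF c A] U that] .
    also have "\<dots> = (\<Sum>s<n. (\<Sum>r<n. cnj (U $$ (r, p)) * A $$ (r, s)) * U $$ (s, q))"
      using that U index_mult_mat_sum[OF c A] by (auto simp: mat_adjoint_index intro!: sum.cong)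
    finally show ?thesis by (simp add: sum_distrib_right)
  qed
  have "quad_form n (mat_adjoint U * A * U) v =
      (\<Sum>p<n. \<Sum>q<n. \<Sum>s<n. \<Sum>r<n. cnj (v p) * cnj (U $$ (r, p)) * A $$ (r, s) * U $$ (s, q) * v q)"
    unfolding quad_form_def by (auto simp: e sum_distrib_right sum_distrib_left mult_ac intro!: sum.cong)
  also have "\<dots> = (\<Sum>r<n. \<Sum>s<n. \<Sum>p<n. \<Sum>q<n. cnj (v p) * cnj (U $$ (r, p)) * A $$ (r, s) * U $$ (s, q) * v q)"
    by (rule sum_swap_pairs)
  also have "\<dots> = quad_form n A (\<lambda>r. \<Sum>s<n. U $$ (r, s) * v s)"
  proof -
    have "cnj (\<Sum>s<n. U $$ (r, s) * v s) * A $$ (r, s) * (\<Sum>q<n. U $$ (s, q) * v q) =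
        (\<Sum>p<n. \<Sum>q<n. cnj (v p) * cnj (U $$ (r, p)) * A $$ (r, s) * U $$ (s, q) * v q)" for r s
      by (simp only: cnj_sum complex_cnj_mult sum_distrib_left sum_distrib_right mult_ac)
    then show ?thesis unfolding quad_form_def by simp
  qed
  finally show ?thesis .
qed

section \<open>Unitary completion and positive square roots\<close>

text \<open>Gram-Schmidt started at \<open>v\<close> keeps \<open>v\<close> as its first vector;
  normalising the orthogonal vectors introduces the factor \<open>c\<close>.\<close>

lemma unitary_first_column:
  assumes v: "v \<in> carrier_vec n" "v \<noteq> 0\<^sub>v n"
  obtains U c where "unitary_mat n U" "col U 0 = c \<cdot>\<^sub>v v"
proof -
  interpret cof_vec_space n "TYPE(complex)" .
  define b where "b = basis_completion v"
  define ws where "ws = gram_schmidt n b"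
  have n: "n > 0" using v by (cases n) auto
  from basis_completion[OF v, folded b_def]
  have dist_b: "distinct b" and indep: "\<not> lin_dep (set b)" and b: "set b \<subseteq> carrier_vec n"
    and hdb: "hd b = v" and len_b: "length b = n" by auto
  from hdb len_b n obtain vs where bv: "b = v # vs" by (cases b) auto
  from gram_schmidt_result[OF b dist_b indep refl, folded ws_def]
  have ws: "set ws \<subseteq> carrier_vec n" "corthogonal ws" "length ws = n" by (auto simp: len_b)
  from gram_schmidt_hd[OF v(1), of vs, folded bv] have hdws: "hd ws = v" unfolding ws_def .
  define c where "c i = complex_of_real (1 / sqrt (Re (ws ! i \<bullet>c ws ! i)))" for i
  define U where "U = Matrix.mat n n (\<lambda>(r, i). c i * (ws ! i $ r))"
  have wsi: "ws ! i \<in> carrier_vec n" if "i < n" for i using ws that by auto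
  have U: "U \<in> carrier_mat n n" by (simp add: U_def)
  have "mat_adjoint U * U = 1\<^sub>m n"
  proof (rule eq_matI)
    fix i j assume "i < dim_row (1\<^sub>m n)" "j < dim_col (1\<^sub>m n)"
    then have ij: "i < n" "j < n" by auto
    have "(mat_adjoint U * U) $$ (i, j) = (\<Sum>r<n. cnj (U $$ (r, i)) * U $$ (r, j))"
      using index_mult_mat_sum[OF mat_adjoint_carrier[OF U] U ij] U ij by (simp add: mat_adjoint_index)
    also have "\<dots> = c i * c j * (\<Sum>r<n. ws ! j $ r * cnj (ws ! i $ r))"
      using ij by (simp add: U_def c_def sum_divide_distrib mult_ac)
    also have "(\<Sum>r<n. ws ! j $ r * cnj (ws ! i $ r)) = ws ! j \<bullet>c ws ! i"
      using wsi[OF ij(1)] wsi[OF ij(2)]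
      by (auto simp: scalar_prod_def conjugate_complex_def atLeast0LessThan intro!: sum.cong)
    also have "c i * c j * (ws ! j \<bullet>c ws ! i) = 1\<^sub>m n $$ (i, j)"
    proof (cases "i = j")
      case False
      then show ?thesis using corthogonalD[OF ws(2), of j i] ij ws(3) by auto
    next
      case True
      have nz: "ws ! i \<bullet>c ws ! i \<noteq> 0" using corthogonalD[OF ws(2), of i i] ij ws(3) by auto
      have "ws ! i \<bullet>c ws ! i = (\<Sum>r<n. ws ! i $ r * cnj (ws ! i $ r))"
        using wsi[OF ij(1)]
        by (auto simp: scalar_prod_def conjugate_complex_def atLeast0LessThan intro!: sum.cong)
      also have "\<dots> = complex_of_real (\<Sum>r<n. (cmod (ws ! i $ r))\<^sup>2)"
        by (simp only: complex_norm_square[symmetric] of_real_sum)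
      finally obtain x where x: "ws ! i \<bullet>c ws ! i = complex_of_real x" "x \<ge> 0"
        by (metis sum_nonneg zero_le_power2)
      with nz have "x > 0" by auto
      then have "c i * c i * (ws ! i \<bullet>c ws ! i) = 1"
        by (simp add: c_def x flip: of_real_mult)
      then show ?thesis using True ij by simp
    qed
    finally show "(mat_adjoint U * U) $$ (i, j) = 1\<^sub>m n $$ (i, j)" .
  qed (use U mat_adjoint_carrier[OF U] in auto)
  moreover have "col U 0 = c 0 \<cdot>\<^sub>v v"
  proof -
    have "ws ! 0 = v" using n hdws ws(3) by (auto simp: hd_conv_nth[symmetric])
    then show ?thesis using n v by (intro eq_vecI) (auto simp: U_def)
  qed
  ultimately show thesis using U that by (auto simp: unitary_mat_def)
qed

text \<open>\<open>psd_sqrt\<close> is a choice, so nothing can be said about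
  \<open>tuple_norm\<close> before a root exists. The induction splits off one eigenvector by a
  unitary change of basis and takes the root of the complementary block.\<close>

lemma psd_sqrt_exists:
  "A \<in> carrier_mat n n \<Longrightarrow> psd A \<Longrightarrow> \<exists>B \<in> carrier_mat n n. psd B \<and> B * B = A"
proof (induction n arbitrary: A)
  case 0
  then show ?case by (intro bexI[of _ A]) (auto intro!: eq_matI)
next
  case (Suc k)
  let ?n = "Suc k"
  note A = Suc.prems(1)
  note psdA = Suc.prems(2)[unfolded psd_iff_quad_form[OF A]]
  obtain e v where ev: "eigenvector A v e"
    using spectrum_non_empty[OF A] by (auto simp: spectrum_def eigenvalue_def)
  then have v: "v \<in> carrier_vec ?n" "v \<noteq> 0\<^sub>v ?n" "A *\<^sub>v v = e \<cdot>\<^sub>v v"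
    using A by (auto simp: eigenvector_def)
  obtain U c where U: "U \<in> carrier_mat ?n ?n" "mat_adjoint U * U = 1\<^sub>m ?n" and col: "col U 0 = c \<cdot>\<^sub>v v"
    using unitary_first_column[OF v(1,2)] unfolding unitary_mat_def by blast
  let ?U = "mat_adjoint U"
  have aU: "?U \<in> carrier_mat ?n ?n" by (rule mat_adjoint_carrier[OF U(1)])
  have UU: "U * ?U = 1\<^sub>m ?n" by (rule mat_mult_left_right_inverse[OF aU U])
  define C where "C = ?U * A * U"
  have C: "C \<in> carrier_mat ?n ?n" using A U aU by (auto simp: C_def)
  have psdC: "\<exists>r\<ge>0. quad_form ?n C w = complex_of_real r" for w
    unfolding C_def quad_form_conj[OF A U(1)] using psdA by blast
  then have psdC': "psd C" by (simp add: psd_iff_quad_form[OF C])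
  \<comment> \<open>The first column of \<open>U\<close> is an eigenvector, so the first column of
    \<open>C\<close> is \<open>e\<close> times the first unit vector; the adjoint condition then
    clears the first row.\<close>
  have C0: "C $$ (i, 0) = e * (if i = 0 then 1 else 0)" if i: "i < ?n" for i
  proof -
    have "(A * U) $$ (r, 0) = e * U $$ (r, 0)" if r: "r < ?n" for r
    proof -
      have "(A * U) $$ (r, 0) = (A *\<^sub>v col U 0) $ r" using A U r by simp
      also have "\<dots> = (e \<cdot>\<^sub>v (c \<cdot>\<^sub>v v)) $ r"
        using A v(1) v(3) by (simp add: col mult_mat_vec smult_smult_assoc mult.commute)
      also have "\<dots> = e * U $$ (r, 0)" using U r by (simp add: col[symmetric])
      finally show ?thesis .
    qed
    then have "C $$ (i, 0) = e * (\<Sum>r<?n. ?U $$ (i, r) * U $$ (r, 0))"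
      unfolding C_def using index_mult_mat_sum[OF aU mult_carrier_mat[OF A U(1)] i, of 0]
      by (simp add: assoc_mult_mat[OF aU A U(1)] sum_distrib_left mult_ac del: sum.lessThan_Suc)
    also have "(\<Sum>r<?n. ?U $$ (i, r) * U $$ (r, 0)) = 1\<^sub>m ?n $$ (i, 0)"
      using index_mult_mat_sum[OF aU U(1) i, of 0] U(2) by simp
    finally show ?thesis using i by simp
  qed
  have C0': "C $$ (0, i) = cnj e * (if i = 0 then 1 else 0)" if "i < ?n" for i
    using mat_adjoint_index[of 0 C i] psdC' C0[OF that] C that by (auto simp: psd_def)
  \<comment> \<open>At the first unit vector the form has the value \<open>e\<close>, which is
    therefore real and nonnegative.\<close>
  obtain l where l: "l \<ge> 0" "e = complex_of_real l"
    using psdC[of "\<lambda>r. if r = 0 then 1 else 0"] C0[of 0]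
    by (auto simp: quad_form_def sum.lessThan_Suc_shift if_distrib cong: if_cong simp del: sum.lessThan_Suc)
  define C3 where "C3 = Matrix.mat k k (\<lambda>(i, j). C $$ (Suc i, Suc j))"
  \<comment> \<open>Test vectors with first entry 0 see only the block \<open>C3\<close>.\<close>
  have "\<exists>r\<ge>0. quad_form k C3 w = complex_of_real r" for w
    using psdC[of "\<lambda>r. if r = 0 then 0 else w (r - 1)"]
    by (simp add: quad_form_def sum.lessThan_Suc_shift C3_def del: sum.lessThan_Suc)
  then obtain B3 where B3: "B3 \<in> carrier_mat k k" "psd B3" "B3 * B3 = C3"
    using Suc.IH[of C3] psd_iff_quad_form[of C3 k] by (auto simp: C3_def)
  define B1 where "B1 = Matrix.mat ?n ?n (\<lambda>(i, j). if i = 0 \<or> j = 0 then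
    (if i = j then complex_of_real (sqrt l) else 0) else B3 $$ (i - 1, j - 1))"
  have B1: "B1 \<in> carrier_mat ?n ?n" by (simp add: B1_def)
  have "B1 * B1 = C"
  proof (rule eq_matI)
    fix i j assume "i < dim_row C" "j < dim_col C"
    then have ij: "i < ?n" "j < ?n" using C by auto
    have "(B1 * B1) $$ (i, j) = B1 $$ (i, 0) * B1 $$ (0, j) + (\<Sum>r<k. B1 $$ (i, Suc r) * B1 $$ (Suc r, j))"
      using index_mult_mat_sum[OF B1 B1 ij] by (simp only: sum.lessThan_Suc_shift)
    also have "\<dots> = C $$ (i, j)"
    proof (cases "i = 0 \<or> j = 0")
      case True
      then show ?thesis using ij C0 C0' l
        by (auto simp: B1_def simp flip: of_real_mult)
    next
      case False
      then have ij': "i - 1 < k" "j - 1 < k" using ij by auto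
      have "(B3 * B3) $$ (i - 1, j - 1) = C $$ (i, j)"
        using ij' False by (simp add: B3(3) C3_def)
      then show ?thesis using False ij index_mult_mat_sum[OF B3(1) B3(1) ij'] by (simp add: B1_def)
    qed
    finally show "(B1 * B1) $$ (i, j) = C $$ (i, j)" .
  qed (use B1 C in auto)
  have psdB1: "\<exists>r\<ge>0. quad_form ?n B1 w = complex_of_real r" for w
  proof -
    obtain r where "r \<ge> 0" "quad_form k B3 (w \<circ> Suc) = complex_of_real r"
      using B3 psd_iff_quad_form by blast
    moreover have "quad_form ?n B1 w = complex_of_real ((cmod (w 0))\<^sup>2 * sqrt l) + quad_form k B3 (w \<circ> Suc)"
      by (simp add: quad_form_def sum.lessThan_Suc_shift B1_def mult_ac del: sum.lessThan_Suc)
        (simp add: complex_norm_square[symmetric, unfolded of_real_power])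
    ultimately show ?thesis using l
      by (intro exI[of _ "(cmod (w 0))\<^sup>2 * sqrt l + r"]) simp
  qed
  \<comment> \<open>Written with \<open>?U\<close> in the role of \<open>U\<close> so that
    \<open>quad_form_conj\<close> applies; the double adjoint is \<open>U\<close> itself.\<close>
  define B where "B = mat_adjoint ?U * B1 * ?U"
  have "mat_adjoint ?U = U"
    using U(1) aU mat_adjoint_carrier[OF aU]
    by (intro eq_matI) (auto simp: mat_adjoint_index carrier_matD[OF aU])
  then have B_eq: "B = U * B1 * ?U" by (simp add: B_def)
  have B: "B \<in> carrier_mat ?n ?n" using B1 U aU by (auto simp: B_eq)
  have "psd B"
    unfolding psd_iff_quad_form[OF B] unfolding B_def quad_form_conj[OF B1 aU] using psdB1 by blast
  moreover have "B * B = A"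
  proof -
    note [simp] = assoc_mult_mat[of _ ?n ?n _ ?n _ ?n] 
    have "B * B = U * (B1 * ((?U * U) * (B1 * ?U)))" unfolding B_eq using U(1) B1 aU by simp
    also have "\<dots> = U * ((B1 * B1) * ?U)" using U B1 aU by simp
    also have "\<dots> = (U * ?U) * (A * (U * ?U))" unfolding \<open>B1 * B1 = C\<close> C_def using U(1) A aU by simp
    also have "\<dots> = A" using UU A by simp
    finally show ?thesis .
  qed
  ultimately show ?case using B by blast
qed

lemma quad_form_eigenvector:
  assumes "A \<in> carrier_mat n n" "v \<in> carrier_vec n" "A *\<^sub>v v = e \<cdot>\<^sub>v v"
  shows "quad_form n A (($) v) = e * complex_of_real (\<Sum>r<n. (cmod (v $ r))\<^sup>2)"
proof -
  have "quad_form n A (($) v) = (e \<cdot>\<^sub>v v) \<bullet>c v"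
    using mult_mat_vec_cscalar_prod_eq_quad_form[OF assms(1,2)] assms(3) by simp
  also have "\<dots> = (\<Sum>r<n. e * (v $ r * cnj (v $ r)))"
    using assms(2) by (auto simp: scalar_prod_def conjugate_complex_def atLeast0LessThan intro!: sum.cong)
  also have "\<dots> = e * complex_of_real (\<Sum>r<n. (cmod (v $ r))\<^sup>2)"
    by (simp only: complex_norm_square[symmetric] of_real_sum sum_distrib_left)
  finally show ?thesis .
qed

lemma sum_norm_squares_pos:
  assumes "v \<in> carrier_vec n" "v \<noteq> 0\<^sub>v n"
  shows "0 < (\<Sum>r<n. (cmod (v $ r))\<^sup>2)"
proof -
  obtain i where "i < n" "v $ i \<noteq> 0" using assms by (metis eq_vecI carrier_vecD index_zero_vec)
  then show ?thesis by (intro sum_pos2[of _ i]) auto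
qed

lemma cmod_quad_form_le:
  "cmod (quad_form n A v) \<le> (\<Sum>r<n. \<Sum>s<n. cmod (A $$ (r, s))) * (\<Sum>r<n. (cmod (v r))\<^sup>2)"
proof -
  let ?N = "\<Sum>r<n. (cmod (v r))\<^sup>2"
  have vv: "cmod (v r) * cmod (v s) \<le> ?N" if "r < n" "s < n" for r s
  proof -
    have "(cmod (v r))\<^sup>2 \<le> ?N" "(cmod (v s))\<^sup>2 \<le> ?N" using that by (auto intro!: member_le_sum)
    moreover have "2 * cmod (v r) * cmod (v s) \<le> (cmod (v r))\<^sup>2 + (cmod (v s))\<^sup>2"
      by (rule sum_squares_bound)
    ultimately show ?thesis by linarith
  qed
  have "cmod (quad_form n A v) \<le> (\<Sum>r<n. \<Sum>s<n. cmod (cnj (v r) * A $$ (r, s) * v s))"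
    unfolding quad_form_def by (rule order_trans[OF norm_sum sum_mono[OF norm_sum]])
  also have "\<dots> \<le> (\<Sum>r<n. \<Sum>s<n. cmod (A $$ (r, s)) * ?N)"
  proof (intro sum_mono)
    fix r s assume "r \<in> {..<n}" "s \<in> {..<n}"
    then have "cmod (A $$ (r, s)) * (cmod (v r) * cmod (v s)) \<le> cmod (A $$ (r, s)) * ?N"
      using vv by (intro mult_left_mono) auto
    then show "cmod (cnj (v r) * A $$ (r, s) * v s) \<le> cmod (A $$ (r, s)) * ?N"
      by (simp add: norm_mult mult_ac)
  qed
  finally show ?thesis by (simp add: sum_distrib_right)
qed

section \<open>The norm of a tuple and scaling into the ball\<close>

lemma sum_squares_mat_index:
  assumes "X \<in> mat_tuples n" "a < n" "b < n"
  shows "sum_squares_mat n X $$ (a, b) = (\<Sum>i\<in>UNIV. \<Sum>k<n. X i $$ (a, k) * cnj (X i $$ (b, k)))"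
proof -
  have X: "X i \<in> carrier_mat n n" for i using assms by (auto simp: mat_tuples_def)
  show ?thesis using assms X index_mult_mat_sum[OF X mat_adjoint_carrier[OF X]]
    by (auto simp: sum_squares_mat_def mat_adjoint_index carrier_matD[OF X] intro!: sum.cong)
qed

text \<open>The form at \<open>v\<close> is the sum over \<open>i\<close> of the squared norms of
  \<open>mat_adjoint (X i)\<close> applied to \<open>v\<close>.\<close>

lemma psd_sum_squares_mat:
  fixes X :: "('g :: finite) tuple"
  assumes X: "X \<in> mat_tuples n"
  shows "psd (sum_squares_mat n X)"
proof -
  have S: "sum_squares_mat n X \<in> carrier_mat n n" by (simp add: sum_squares_mat_def)
  have eq: "quad_form n (sum_squares_mat n X) v =
      complex_of_real (\<Sum>i\<in>UNIV. \<Sum>k<n. (cmod (\<Sum>a<n. cnj (v a) * X i $$ (a, k)))\<^sup>2)" for v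
  proof -
    have sq: "complex_of_real ((cmod (\<Sum>a<n. cnj (v a) * X i $$ (a, k)))\<^sup>2) =
        (\<Sum>a<n. \<Sum>b<n. cnj (v a) * X i $$ (a, k) * (cnj (X i $$ (b, k)) * v b))" for i k
      unfolding complex_norm_square cnj_sum sum_product by (simp add: mult.commute[of "v _"])
    have "quad_form n (sum_squares_mat n X) v = (\<Sum>a<n. \<Sum>b<n. \<Sum>i\<in>UNIV. \<Sum>k<n.
        cnj (v a) * X i $$ (a, k) * (cnj (X i $$ (b, k)) * v b))"
      unfolding quad_form_def using sum_squares_mat_index[OF X]
      by (auto simp: sum_distrib_left sum_distrib_right mult_ac intro!: sum.cong)
    also have "\<dots> = (\<Sum>a<n. \<Sum>i\<in>UNIV. \<Sum>b<n. \<Sum>k<n.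
        cnj (v a) * X i $$ (a, k) * (cnj (X i $$ (b, k)) * v b))"
      by (rule sum.cong[OF refl], rule sum.swap)
    also have "\<dots> = (\<Sum>i\<in>UNIV. \<Sum>a<n. \<Sum>b<n. \<Sum>k<n.
        cnj (v a) * X i $$ (a, k) * (cnj (X i $$ (b, k)) * v b))"
      by (rule sum.swap)
    also have "\<dots> = (\<Sum>i\<in>UNIV. \<Sum>a<n. \<Sum>k<n. \<Sum>b<n.
        cnj (v a) * X i $$ (a, k) * (cnj (X i $$ (b, k)) * v b))"
      by (rule sum.cong[OF refl], rule sum.cong[OF refl], rule sum.swap)
    also have "\<dots> = (\<Sum>i\<in>UNIV. \<Sum>k<n. \<Sum>a<n. \<Sum>b<n.
        cnj (v a) * X i $$ (a, k) * (cnj (X i $$ (b, k)) * v b))"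
      by (rule sum.cong[OF refl], rule sum.swap)
    finally show ?thesis unfolding of_real_sum sq .
  qed
  have nonneg: "0 \<le> (\<Sum>i\<in>UNIV. \<Sum>k<n. (cmod (\<Sum>a<n. cnj (v a) * X i $$ (a, k)))\<^sup>2)" for v
    by (intro sum_nonneg zero_le_power2)
  show ?thesis unfolding psd_iff_quad_form[OF S] eq
    by (intro allI exI conjI, rule nonneg, rule refl)
qed

text \<open>The square of an eigenvalue of the root is an eigenvalue of the sum of squares, and a
  Rayleigh quotient is at most the sum of the absolute values of the entries. The crude bound
  suffices, since its only use is that scaled tuples become small.\<close>

lemma tuple_norm_le:
  fixes X :: "('g :: finite) tuple"
  assumes n: "n \<ge> 1" and X: "X \<in> mat_tuples n"
    and C: "0 \<le> C" "(\<Sum>r<n. \<Sum>s<n. cmod (sum_squares_mat n X $$ (r, s))) \<le> C\<^sup>2"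
  shows "tuple_norm n X \<le> C"
proof -
  define S where "S = sum_squares_mat n X"
  have S: "S \<in> carrier_mat n n" by (simp add: S_def sum_squares_mat_def)
  define B where "B = psd_sqrt S"
  have "\<exists>B. psd B \<and> B * B = S"
    using psd_sqrt_exists[OF S] psd_sum_squares_mat[OF X] by (auto simp: S_def)
  then have B: "psd B" "B * B = S"
    unfolding B_def psd_sqrt_def by (metis (mono_tags, lifting) someI_ex)+
  have Bc: "B \<in> carrier_mat n n"
    using B S by (metis carrier_matD(1) index_mult_mat(2) psd_def)
  note psdB = B(1)[unfolded psd_iff_quad_form[OF Bc]]
  let ?E = "{r :: real. eigenvalue B (complex_of_real r)}"
  have "finite ?E"
    using finite_vimageI[OF card_finite_spectrum(1)[OF Bc], of complex_of_real]
    by (simp add: spectrum_def vimage_def inj_on_def)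
  \<comment> \<open>\<open>Max\<close> is meaningful only on a nonempty finite set:
    \<open>n \<ge> 1\<close> provides an eigenvalue, and positivity makes it real.\<close>
  moreover have "?E \<noteq> {}"
  proof -
    obtain v e where v: "v \<in> carrier_vec n" "v \<noteq> 0\<^sub>v n" "B *\<^sub>v v = e \<cdot>\<^sub>v v" and e: "eigenvalue B e"
      using spectrum_non_empty[OF Bc] n Bc by (fastforce simp: spectrum_def eigenvalue_def eigenvector_def)
    obtain r where "e * complex_of_real (\<Sum>r<n. (cmod (v $ r))\<^sup>2) = complex_of_real r"
      using psdB quad_form_eigenvector[OF Bc v(1,3)] by metis
    then have "e = complex_of_real (r / (\<Sum>r<n. (cmod (v $ r))\<^sup>2))"
      using sum_norm_squares_pos[OF v(1,2)]
      by (metis nonzero_eq_divide_eq of_real_divide of_real_eq_0_iff order_less_irrefl)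
    with e show ?thesis by blast
  qed
  moreover have "r \<le> C" if r: "r \<in> ?E" for r
  proof -
    obtain v where v: "v \<in> carrier_vec n" "v \<noteq> 0\<^sub>v n" "B *\<^sub>v v = complex_of_real r \<cdot>\<^sub>v v"
      using r Bc by (fastforce simp: eigenvalue_def eigenvector_def)
    let ?N = "\<Sum>r<n. (cmod (v $ r))\<^sup>2"
    have N: "?N > 0" by (rule sum_norm_squares_pos[OF v(1,2)])
    have "S *\<^sub>v v = B *\<^sub>v (B *\<^sub>v v)" using Bc v(1) by (simp add: B(2)[symmetric])
    also have "\<dots> = complex_of_real (r\<^sup>2) \<cdot>\<^sub>v v"
      using Bc v by (simp add: mult_mat_vec smult_smult_assoc power2_eq_square)
    finally have "quad_form n S (($) v) = complex_of_real (r\<^sup>2) * complex_of_real ?N"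
      by (rule quad_form_eigenvector[OF S v(1)])
    then have "quad_form n S (($) v) = complex_of_real (r\<^sup>2 * ?N)" by (simp only: of_real_mult)
    then have "cmod (quad_form n S (($) v)) = r\<^sup>2 * ?N" using N by (simp only: norm_of_real) simp
    then have "r\<^sup>2 * ?N \<le> C\<^sup>2 * ?N"
      using cmod_quad_form_le[of n S "($) v"] C(2) N unfolding S_def
      by (smt (verit) mult_right_mono)
    then have "r\<^sup>2 \<le> C\<^sup>2" using N by simp
    then show ?thesis using C(1) by (rule power2_le_imp_le)
  qed
  ultimately show ?thesis
    unfolding tuple_norm_def max_eigenvalue_def B_def[symmetric, unfolded S_def] by simp
qed

definition scale_tuple :: "complex \<Rightarrow> 'g tuple \<Rightarrow> 'g tuple" where
  "scale_tuple z X = (\<lambda>i. z \<cdot>\<^sub>m X i)"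

lemma scale_tuple_mat_tuples: "X \<in> mat_tuples n \<Longrightarrow> scale_tuple z X \<in> mat_tuples n"
  by (simp add: scale_tuple_def mat_tuples_def)

lemma scale_tuple_herm_tuples:
  assumes "X \<in> herm_tuples n"
  shows "scale_tuple (complex_of_real t) X \<in> herm_tuples n"
proof -
  have X: "X i \<in> carrier_mat n n" "mat_adjoint (X i) = X i" for i
    using assms by (auto simp: herm_tuples_def mat_tuples_def)
  have "mat_adjoint (complex_of_real t \<cdot>\<^sub>m X i) = complex_of_real t \<cdot>\<^sub>m X i" for i
  proof (rule eq_matI)
    fix a b assume "a < dim_row (complex_of_real t \<cdot>\<^sub>m X i)" "b < dim_col (complex_of_real t \<cdot>\<^sub>m X i)"
    then have "a < n" "b < n" using X(1)[of i] by auto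
    then show "mat_adjoint (complex_of_real t \<cdot>\<^sub>m X i) $$ (a, b) = (complex_of_real t \<cdot>\<^sub>m X i) $$ (a, b)"
      using X(1)[of i] mat_adjoint_index[of a "X i" b] X(2)[of i] by (simp add: mat_adjoint_index)
  qed (use X(1)[of i] mat_adjoint_carrier[of "complex_of_real t \<cdot>\<^sub>m X i" n n] in auto)
  then show ?thesis using assms by (auto simp: herm_tuples_def scale_tuple_def mat_tuples_def)
qed

text \<open>Scaling by \<open>t\<close> multiplies every entry of the sum of squares by
  \<open>t\<^sup>2\<close>, so the entrywise bound on the norm becomes a multiple of
  \<open>\<bar>t\<bar>\<close>.\<close>

lemma scale_tuple_in_herm_ball:
  fixes X :: "('g :: finite) tuple"
  assumes n: "n \<ge> 1" and X: "X \<in> herm_tuples n" and "\<epsilon> > 0"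
  shows "\<exists>\<delta>>0. \<forall>t. \<bar>t\<bar> < \<delta> \<longrightarrow> scale_tuple (complex_of_real t) X \<in> herm_ball n \<epsilon>"
proof -
  have Xm: "X \<in> mat_tuples n" using X by (simp add: herm_tuples_def)
  define K where "K = (\<Sum>r<n. \<Sum>s<n. cmod (sum_squares_mat n X $$ (r, s)))"
  have "K \<ge> 0" by (simp add: K_def sum_nonneg)
  have bound: "tuple_norm n (scale_tuple (complex_of_real t) X) \<le> \<bar>t\<bar> * sqrt K" for t
  proof (rule tuple_norm_le[OF n scale_tuple_mat_tuples[OF Xm]])
    have "sum_squares_mat n (scale_tuple (complex_of_real t) X) $$ (r, s) =
        complex_of_real (t\<^sup>2) * sum_squares_mat n X $$ (r, s)" if rs: "r < n" "s < n" for r s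
      unfolding sum_squares_mat_index[OF Xm rs] sum_squares_mat_index[OF scale_tuple_mat_tuples[OF Xm] rs]
      using rs Xm by (auto simp: scale_tuple_def sum_distrib_left power2_eq_square mat_tuples_def
          carrier_matD[of "X _" n n] intro!: sum.cong)
    then have "(\<Sum>r<n. \<Sum>s<n. cmod (sum_squares_mat n (scale_tuple (complex_of_real t) X) $$ (r, s))) = t\<^sup>2 * K"
      by (simp add: K_def sum_distrib_left norm_mult norm_power)
    then show "(\<Sum>r<n. \<Sum>s<n. cmod (sum_squares_mat n (scale_tuple (complex_of_real t) X) $$ (r, s)))
        \<le> (\<bar>t\<bar> * sqrt K)\<^sup>2"
      using \<open>K \<ge> 0\<close> by (simp add: power_mult_distrib)
  qed (use \<open>K \<ge> 0\<close> in auto)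
  show ?thesis
  \<comment> \<open>The added 1 keeps the denominator positive when \<open>K = 0\<close>.\<close>
  proof (intro exI[of _ "\<epsilon> / (sqrt K + 1)"] conjI allI impI)
    show "0 < \<epsilon> / (sqrt K + 1)" using \<open>\<epsilon> > 0\<close> \<open>K \<ge> 0\<close> by (simp add: add_nonneg_pos)
    fix t assume t: "\<bar>t\<bar> < \<epsilon> / (sqrt K + 1)"
    have "sqrt K + 1 > 0" using \<open>K \<ge> 0\<close> by (simp add: add_nonneg_pos)
    then have "\<bar>t\<bar> * (sqrt K + 1) < \<epsilon>" using t by (simp add: pos_less_divide_eq)
    then have "tuple_norm n (scale_tuple (complex_of_real t) X) < \<epsilon>"
      using bound[of t] by (simp add: distrib_left)
    then show "scale_tuple (complex_of_real t) X \<in> herm_ball n \<epsilon>"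
      using scale_tuple_herm_tuples[OF X] by (simp add: herm_ball_def)
  qed
qed

section \<open>Series with nonnegative coefficients\<close>

text \<open>Nothing makes the open set \<open>S\<close> connected, so the identity theorem runs on
  its component of 0, which is open and swallows the connected set \<open>T\<close>.\<close>

lemma real_line_identity:
  fixes f g :: "complex \<Rightarrow> complex"
  assumes S: "open S" and f: "f holomorphic_on S" and g: "g holomorphic_on S"
    and T: "connected T" "T \<subseteq> S" "0 \<in> T"
    and "\<delta> > 0" and eq: "\<And>t :: real. \<bar>t\<bar> < \<delta> \<Longrightarrow> f (of_real t) = g (of_real t)"
  obtains C where "open C" "T \<subseteq> C" "C \<subseteq> S" "\<And>z. z \<in> C \<Longrightarrow> f z = g z"
proof
  define C where "C = connected_component_set S 0"
  show oC: "open C" unfolding C_def using S by (rule open_connected_component)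
  show "T \<subseteq> C" unfolding C_def using T by (intro connected_component_maximal) auto
  show CS: "C \<subseteq> S" unfolding C_def by (rule connected_component_subset)
  have C0: "0 \<in> C" using T \<open>T \<subseteq> C\<close> by auto
  from oC C0 obtain e where e: "e > 0" "ball 0 e \<subseteq> C" by (meson openE)
  define U :: "complex set" where "U = complex_of_real ` {t. \<bar>t\<bar> < min \<delta> e}"
  have lim: "0 islimpt U"
  proof (subst islimpt_approachable, intro allI impI)
    fix r :: real assume "r > 0"
    define t where "t = min (min \<delta> e) r / 2"
    have "t > 0" "t < \<delta>" "t < e" "t < r"
      using \<open>r > 0\<close> \<open>\<delta> > 0\<close> e by (auto simp: t_def min_def)
    then show "\<exists>x'\<in>U. x' \<noteq> 0 \<and> dist x' 0 < r"
      by (intro bexI[of _ "of_real t"]) (auto simp: U_def)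
  qed
  fix z assume z: "z \<in> C"
  have "f z - g z = 0"
  proof (rule analytic_continuation[of "\<lambda>z. f z - g z" C U 0 z])
    show "(\<lambda>z. f z - g z) holomorphic_on C"
      using f g CS by (intro holomorphic_intros) (auto intro: holomorphic_on_subset)
    show "connected C" by (simp add: C_def)
    show "U \<subseteq> C" using e(2) by (auto simp: U_def)
    show "\<And>z. z \<in> U \<Longrightarrow> f z - g z = 0" using eq by (auto simp: U_def)
  qed (use oC C0 lim z in auto)
  then show "f z = g z" by simp
qed

text \<open>Termwise differentiation shifts the coefficients and multiplies them by positive
  integers, so their signs survive.\<close>

lemma higher_deriv_nonneg_power_series:
  fixes q :: "complex \<Rightarrow> complex" and a :: "nat \<Rightarrow> real"
  assumes "\<And>k. 0 \<le> a k" and "\<And>z. norm z < R \<Longrightarrow> (\<lambda>k. of_real (a k) * z ^ k) sums q z"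
  shows "\<exists>b. (\<forall>k. 0 \<le> b k) \<and>
    (\<forall>z. norm z < R \<longrightarrow> (\<lambda>k. of_real (b k) * z ^ k) sums (deriv ^^ j) q z)"
proof (induction j)
  case 0
  then show ?case using assms by (auto intro!: exI[of _ a])
next
  case (Suc j)
  then obtain b where b: "\<And>k. 0 \<le> b k"
    "\<And>z. norm z < R \<Longrightarrow> (\<lambda>k. of_real (b k) * z ^ k) sums (deriv ^^ j) q z" by blast
  define c :: "nat \<Rightarrow> complex" where "c = (\<lambda>k. of_real (b k))"
  have c: "(\<lambda>k. c k * z ^ k) sums (deriv ^^ j) q z" if "norm z < R" for z
    using b(2)[OF that] by (simp add: c_def)
  have dc: "diffs c k = of_real (diffs b k)" for k
    by (simp add: diffs_def c_def)
  show ?case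
  proof (intro exI[of _ "diffs b"] conjI allI impI)
    show "0 \<le> diffs b k" for k using b(1) by (simp add: diffs_def)
    fix z :: complex assume z: "norm z < R"
    have "DERIV (\<lambda>z. suminf (\<lambda>k. c k * z ^ k)) z :> suminf (\<lambda>k. diffs c k * z ^ k)"
      using c z by (intro termdiffs_strong') (auto simp: sums_iff)
    moreover have "eventually (\<lambda>z. suminf (\<lambda>k. c k * z ^ k) = (deriv ^^ j) q z) (nhds z)"
      using z c by (intro eventually_nhds_in_open[THEN eventually_mono, of "ball 0 R"])
        (auto simp: sums_iff)
    ultimately have "DERIV ((deriv ^^ j) q) z :> suminf (\<lambda>k. diffs c k * z ^ k)"
      using DERIV_cong_ev[OF refl _ refl, of "\<lambda>z. suminf (\<lambda>k. c k * z ^ k)" "(deriv ^^ j) q" z] by blast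
    then have "deriv ((deriv ^^ j) q) z = suminf (\<lambda>k. diffs c k * z ^ k)" by (rule DERIV_imp_deriv)
    moreover have "summable (\<lambda>k. diffs c k * z ^ k)"
      using z c by (intro termdiff_converges[of z R]) (auto simp: sums_iff)
    ultimately show "(\<lambda>k. of_real (diffs b k) * z ^ k) sums (deriv ^^ Suc j) q z"
      by (simp add: dc sums_iff)
  qed
qed

text \<open>The heart of Pringsheim's theorem: up to factorials, the Taylor coefficients of
  \<open>G\<close> at \<open>x\<close> are derivatives of \<open>q\<close> at a nonnegative point,
  hence nonnegative, and the Taylor series represents \<open>G\<close> on the whole ball, even where
  this reaches beyond \<open>R\<close>.\<close>

lemma nonneg_continuation:
  fixes q G :: "complex \<Rightarrow> complex" and a :: "nat \<Rightarrow> real"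
  assumes a: "\<And>k. 0 \<le> a k" and q: "\<And>z. norm z < R \<Longrightarrow> (\<lambda>k. of_real (a k) * z ^ k) sums q z"
    and x: "0 \<le> x" "x < R" and G: "G holomorphic_on ball (of_real x) \<rho>"
    and eq: "eventually (\<lambda>z. G z = q z) (nhds (of_real x))" and h: "0 \<le> h" "h < \<rho>"
  shows "0 \<le> Re (G (of_real (x + h)))"
proof -
  have nonneg: "\<exists>r\<ge>0. (deriv ^^ j) G (of_real x) = of_real r" for j
  proof -
    obtain b where b: "\<And>k. 0 \<le> b k"
      "\<And>z. norm z < R \<Longrightarrow> (\<lambda>k. of_real (b k) * z ^ k) sums (deriv ^^ j) q z"
      using higher_deriv_nonneg_power_series[OF a q] by blast
    have s: "(\<lambda>k. complex_of_real (b k * x ^ k)) sums (deriv ^^ j) q (of_real x)"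
      using b(2)[of "of_real x"] x by simp
    then have "summable (\<lambda>k. b k * x ^ k)"
      by (simp only: sums_iff summable_complex_of_real)
    then have "(\<lambda>k. complex_of_real (b k * x ^ k)) sums of_real (suminf (\<lambda>k. b k * x ^ k))"
      by (intro sums_of_real summable_sums)
    with s have "(deriv ^^ j) q (of_real x) = of_real (suminf (\<lambda>k. b k * x ^ k))"
      by (rule sums_unique2)
    moreover have "0 \<le> suminf (\<lambda>k. b k * x ^ k)"
      using \<open>summable _\<close> b(1) x by (intro suminf_nonneg) auto
    moreover have "(deriv ^^ j) G (of_real x) = (deriv ^^ j) q (of_real x)"
      using eq by (rule higher_deriv_cong_ev) simp
    ultimately show ?thesis by auto
  qed
  have s: "(\<lambda>j. (deriv ^^ j) G (of_real x) / fact j * (of_real (x + h) - of_real x) ^ j)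
      sums G (of_real (x + h))"
    using h by (intro holomorphic_power_series[OF G]) (auto simp: dist_norm)
  have "0 \<le> Re ((deriv ^^ j) G (of_real x) / fact j * (of_real (x + h) - of_real x) ^ j)" for j
  proof -
    obtain r where "r \<ge> 0" "(deriv ^^ j) G (of_real x) = of_real r" using nonneg by blast
    moreover from this have "(deriv ^^ j) G (of_real x) / fact j * (of_real (x + h) - of_real x) ^ j
        = of_real (r / fact j * h ^ j)" by simp
    ultimately show ?thesis using h by (simp only: Re_complex_of_real) simp
  qed
  then show ?thesis by (rule sums_le[OF _ sums_zero sums_Re[OF s]])
qed

text \<open>Subtracting a partial sum leaves nonnegative coefficients, so the value of \<open>g\<close> slightly beyond the
  radius of convergence bounds every partial sum there; this is the contradiction below.\<close>

theorem nonneg_power_series_continuation_summable: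
  fixes g :: "complex \<Rightarrow> complex" and a :: "nat \<Rightarrow> real"
  assumes V: "open V" "\<And>t :: real. of_real t \<in> V" and g: "g holomorphic_on V"
    and a: "\<And>k. 0 \<le> a k" and "\<delta> > 0"
    and sums: "\<And>t :: real. \<bar>t\<bar> < \<delta> \<Longrightarrow> (\<lambda>k. of_real (a k) * of_real t ^ k) sums g (of_real t)"
  shows "summable (\<lambda>k. a k * t ^ k)"
proof (rule ccontr)
  assume nt: "\<not> summable (\<lambda>k. a k * t ^ k)"
  define c :: "nat \<Rightarrow> complex" where "c = (\<lambda>k. of_real (a k))"
  have "conv_radius c \<noteq> \<infinity>"
  proof
    assume "conv_radius c = \<infinity>"
    then have "summable (\<lambda>k. c k * of_real t ^ k)"
      by (intro summable_in_conv_radius) simp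
    then have "summable (\<lambda>k. complex_of_real (a k * t ^ k))" by (simp add: c_def)
    then show False using nt by (simp only: summable_complex_of_real)
  qed
  moreover have "conv_radius c \<ge> ereal (\<delta> / 2)"
  proof -
    have "summable (\<lambda>k. c k * complex_of_real (\<delta> / 2) ^ k)"
      using sums[of "\<delta> / 2"] \<open>\<delta> > 0\<close> by (auto simp: c_def sums_iff)
    then have "conv_radius c \<ge> norm (complex_of_real (\<delta> / 2))" by (rule conv_radius_geI)
    then show ?thesis using \<open>\<delta> > 0\<close> by simp
  qed
  ultimately obtain R where R: "conv_radius c = ereal R" "R \<ge> \<delta> / 2"
    by (cases "conv_radius c") auto
  have "R > 0" using R \<open>\<delta> > 0\<close> by simp
  define p where "p = (\<lambda>z. suminf (\<lambda>k. c k * z ^ k))"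
  have p: "(\<lambda>k. c k * z ^ k) sums p z" if "norm z < R" for z
    unfolding p_def using that R by (intro summable_sums summable_in_conv_radius) simp
  have "p holomorphic_on ball 0 R"
    using p by (intro power_series_holomorphic[of 0 R c]) (simp add: dist_norm)
  let ?T = "complex_of_real ` {- R<..<R}"
  \<comment> \<open>Agreement of \<open>g\<close> with the series is known only near 0; this extends
    it to the real points of the disc, in particular to a neighbourhood of the \<open>x\<close>
    chosen below.\<close>
  obtain C where C: "open C" "?T \<subseteq> C" "C \<subseteq> V \<inter> ball 0 R" "\<And>z. z \<in> C \<Longrightarrow> g z = p z"
  proof (rule real_line_identity[of "V \<inter> ball 0 R" g p ?T "min \<delta> R"])
    show "g holomorphic_on V \<inter> ball 0 R" "p holomorphic_on V \<inter> ball 0 R"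
      using g \<open>p holomorphic_on _\<close> by (auto intro: holomorphic_on_subset)
    show "connected ?T" by (intro connected_continuous_image continuous_intros) auto
    show "g (of_real t) = p (of_real t)" if "\<bar>t\<bar> < min \<delta> R" for t
      using sums[of t] p[of "of_real t"] that by (auto simp: c_def intro: sums_unique2)
  qed (use V \<open>R > 0\<close> \<open>\<delta> > 0\<close> in auto)
  obtain e where e: "e > 0" "ball (complex_of_real R) e \<subseteq> V"
    using V by (meson openE)
  \<comment> \<open>The point \<open>x\<close> lies \<open>\<rho> / 2\<close> to the left of
    \<open>R\<close>, so whatever is within \<open>\<rho>\<close> of \<open>x\<close> is within
    \<open>3 * e / 4\<close> of \<open>R\<close> and hence in \<open>V\<close>. The bound
    \<open>\<rho> \<le> R\<close> keeps \<open>x\<close> nonnegative, and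
    \<open>h = 3 * \<rho> / 4\<close> steps past \<open>R\<close> but stays in the ball.\<close>
  define \<rho> where "\<rho> = min R (e / 2)"
  define x where "x = R - \<rho> / 2"
  have \<rho>: "0 < \<rho>" "\<rho> \<le> R" "\<rho> \<le> e / 2" using e \<open>R > 0\<close> by (auto simp: \<rho>_def)
  then have x: "0 \<le> x" "x < R" by (auto simp: x_def)
  have ball: "ball (of_real x) \<rho> \<subseteq> V"
  proof (rule subset_trans[OF _ e(2)], rule subsetI)
    fix z assume "z \<in> ball (complex_of_real x) \<rho>"
    moreover have "dist (complex_of_real x) (of_real R) = \<rho> / 2"
      using \<rho> by (simp add: x_def dist_norm flip: of_real_diff)
    moreover have "dist (of_real R) z \<le> dist (of_real R) (complex_of_real x) + dist (of_real x) z"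
      by (rule dist_triangle)
    ultimately show "z \<in> ball (of_real R) e" using \<rho> by (simp add: dist_commute)
  qed
  define h where "h = 3 * \<rho> / 4"
  have h: "0 \<le> h" "h < \<rho>" "R < x + h" using \<rho> by (auto simp: h_def x_def)
  have partial: "(\<Sum>k<K. a k * (x + h) ^ k) \<le> Re (g (of_real (x + h)))" for K
  proof -
    define P where "P = (\<lambda>z. \<Sum>k<K. c k * z ^ k)"
    have "0 \<le> Re (g (of_real (x + h)) - P (of_real (x + h)))"
    proof (rule nonneg_continuation[of "\<lambda>k. if k < K then 0 else a k" R "\<lambda>z. p z - P z" x
          "\<lambda>z. g z - P z" \<rho> h])
      fix z :: complex assume "norm z < R"
      have "(\<lambda>k. if k \<in> {..<K} then c k * z ^ k else 0) sums P z"
        unfolding P_def by (rule sums_If_finite_set) simp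
      from sums_diff[OF p[OF \<open>norm z < R\<close>] this]
      show "(\<lambda>k. of_real (if k < K then 0 else a k) * z ^ k) sums (p z - P z)"
        by (rule sums_cong[THEN iffD1, rotated]) (auto simp: c_def)
    next
      show "(\<lambda>z. g z - P z) holomorphic_on ball (complex_of_real x) \<rho>"
        unfolding P_def by (intro holomorphic_intros holomorphic_on_subset[OF g ball])
      have "of_real x \<in> C" using C(2) x \<open>R > 0\<close> by auto
      then show "\<forall>\<^sub>F z in nhds (complex_of_real x). g z - P z = p z - P z"
        using C(1,4) by (intro eventually_mono[OF eventually_nhds_in_open[of C]]) auto
    qed (use a x h in auto)
    moreover have "P (of_real (x + h)) = of_real (\<Sum>k<K. a k * (x + h) ^ k)"
      by (simp add: P_def c_def)
    ultimately show ?thesis by (simp only: minus_complex.simps Re_complex_of_real)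
  qed
  have "summable (\<lambda>k. a k * (x + h) ^ k)"
  proof (rule bounded_imp_summable)
    show "(\<Sum>k\<le>K. a k * (x + h) ^ k) \<le> Re (g (of_real (x + h)))" for K
      using partial[of "Suc K"] by (simp only: lessThan_Suc_atMost)
  qed (use a x h in auto)
  then have "summable (\<lambda>k. complex_of_real (a k * (x + h) ^ k))"
    by (simp only: summable_complex_of_real)
  then have "summable (\<lambda>k. c k * complex_of_real (x + h) ^ k)" by (simp add: c_def)
  then have "conv_radius c \<ge> norm (complex_of_real (x + h))" by (rule conv_radius_geI)
  then show False using R h x by (simp flip: of_real_add)
qed

section \<open>Hankel positivity combined with analytic continuation\<close>

text \<open>The expansion is assumed only at small real points, because that is what small real
  multiples of a Hermitian tuple provide. The Hankel form is tested on two indices at a time, since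
  only its 2 x 2 minors enter.\<close>

lemma hankel_psd_real_entire_imp_quadratic:
  fixes h :: "complex \<Rightarrow> complex" and a :: "nat \<Rightarrow> complex"
  assumes V: "open V" "\<And>t :: real. of_real t \<in> V" and h: "h holomorphic_on V"
    and "\<delta> > 0"
    and sums: "\<And>t :: real. \<bar>t\<bar> < \<delta> \<Longrightarrow> (\<lambda>k. a k * of_real t ^ k) sums h (of_real t)"
    and hankel: "\<And>i j (x :: real) y. \<exists>r\<ge>0. of_real (x\<^sup>2) * a (2 * i + 2) +
      of_real (2 * x * y) * a (i + j + 2) + of_real (y\<^sup>2) * a (2 * j + 2) = of_real r"
  shows "h (of_real t) = a 0 + a 1 * of_real t + a 2 * (of_real t)\<^sup>2"
proof -
  define b where "b k = Re (a (k + 2))" for k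
  have even: "0 \<le> b (2 * i)" "a (2 * i + 2) = of_real (b (2 * i))" for i
    using hankel[of 1 i 0] by (auto simp: b_def)
  have real: "a (k + 2) = of_real (b k)" for k
  proof -
    \<comment> \<open>With \<open>x = y = 1\<close> and \<open>i = 0\<close> the outer terms are
      already known to be real, which forces the mixed term to be real.\<close>
    obtain r where "a 2 + 2 * a (k + 2) + a (2 * k + 2) = complex_of_real r"
      using hankel[of 1 0 1 k] by (auto simp: numeral_2_eq_2)
    then have "2 * Im (a (k + 2)) = 0"
      using even[of 0] even[of k] by (simp add: complex_eq_iff numeral_2_eq_2)
    then show ?thesis by (simp add: b_def complex_eq_iff)
  qed
  have form: "0 \<le> x\<^sup>2 * b (2 * i) + 2 * x * y * b (i + j) + y\<^sup>2 * b (2 * j)" for x y :: real and i j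
  proof -
    obtain r where r: "r \<ge> 0" "of_real (x\<^sup>2) * a (2 * i + 2) +
      of_real (2 * x * y) * a (i + j + 2) + of_real (y\<^sup>2) * a (2 * j + 2) = complex_of_real r"
      using hankel by blast
    then have "complex_of_real (x\<^sup>2 * b (2 * i) + 2 * x * y * b (i + j) + y\<^sup>2 * b (2 * j)) = of_real r"
      unfolding real by simp
    then show ?thesis using r(1) by (simp only: of_real_eq_iff)
  qed
  have det: "(b (i + j))\<^sup>2 \<le> b (2 * i) * b (2 * j)" for i j
  proof (cases "b (2 * j) = 0")
    case True
    have "b (i + j) = 0"
    proof (rule ccontr)
      assume nz: "b (i + j) \<noteq> 0"
      \<comment> \<open>This value makes the form at \<open>x = 1\<close> equal to -1.\<close>
      define y where "y = - (b (2 * i) + 1) / (2 * b (i + j))"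
      have "2 * 1 * y * b (i + j) = - (b (2 * i) + 1)" using nz by (simp add: y_def)
      then show False using form[of 1 i y j] True by simp
    qed
    with True show ?thesis by simp
  next
    case False
    then have pos: "b (2 * j) > 0" using even(1)[of j] by simp
    \<comment> \<open>The vector \<open>(b (2 * j), - b (i + j))\<close> completes the square and
      leaves the determinant times \<open>b (2 * j)\<close>.\<close>
    have "0 \<le> b (2 * j) * (b (2 * i) * b (2 * j) - (b (i + j))\<^sup>2)"
      using form[of "b (2 * j)" i "- b (i + j)" j] by (simp add: algebra_simps power2_eq_square)
    with pos show ?thesis by (simp add: zero_le_mult_iff)
  qed
  have "b 2 = 0"
  proof (rule ccontr)
    assume "b 2 \<noteq> 0"
    then have b2: "b 2 > 0" using even(1)[of 1] by simp
    have "(b 2)\<^sup>2 \<le> b 0 * b (2 * 2)" using det[of 0 2] by (simp only: add_0_left mult_0_right)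
    then have "b 0 \<noteq> 0" using b2 by auto
    then have b0: "b 0 > 0" using even(1)[of 0] by simp
    \<comment> \<open>The first ratio of consecutive even coefficients. Log-convexity makes these
      ratios nondecreasing, so the even coefficients grow at least like powers of
      \<open>\<rho>\<close>.\<close>
    define \<rho> where "\<rho> = b 2 / b 0"
    have "\<rho> > 0" using b0 b2 by (simp add: \<rho>_def)
    have growth: "0 < b (2 * k) \<and> \<rho> * b (2 * k) \<le> b (2 * k + 2)" for k
    proof (induction k)
      case 0
      then show ?case using b0 by (simp add: \<rho>_def numeral_2_eq_2)
    next
      case (Suc k)
      have pos: "0 < b (2 * k + 2)"
        using Suc \<open>\<rho> > 0\<close> by (meson less_le_trans mult_pos_pos)
      have e: "k + (k + 2) = 2 * k + 2" "2 * (k + 2) = 2 * k + 4" "2 * Suc k = 2 * k + 2" by simp_all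
      have "(b (2 * k + 2))\<^sup>2 \<le> b (2 * k) * b (2 * k + 4)"
        using det[of k "k + 2"] by (simp only: e)
      moreover have "\<rho> * b (2 * k) * b (2 * k + 2) \<le> (b (2 * k + 2))\<^sup>2"
        using Suc pos by (simp add: power2_eq_square)
      ultimately have "b (2 * k) * (\<rho> * b (2 * k + 2)) \<le> b (2 * k) * b (2 * k + 4)"
        by (simp add: mult_ac)
      then have "\<rho> * b (2 * k + 2) \<le> b (2 * k + 4)" using Suc by (simp only: mult_le_cancel_left_pos)
      moreover have "2 * k + 2 + 2 = 2 * k + 4" by simp
      ultimately show ?case unfolding e(3) using pos by (simp only: simp_thms)
    qed
    have lower: "b 0 * \<rho> ^ k \<le> b (2 * k)" for k
    proof (induction k)
      case (Suc k)
      have "b 0 * \<rho> ^ Suc k \<le> \<rho> * b (2 * k)"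
        using mult_left_mono[OF Suc, of \<rho>] \<open>\<rho> > 0\<close> by (simp add: mult_ac)
      also have "\<dots> \<le> b (2 * Suc k)" using growth[of k] by simp
      finally show ?case .
    qed simp
    \<comment> \<open>The factor \<open>s ^ (2 * k + 2)\<close> cancels this growth up to
      \<open>1 / \<rho>\<close>, so the terms stay at least \<open>b 0 / \<rho>\<close> and cannot
      tend to 0.\<close>
    define s where "s = sqrt (1 / \<rho>)"
    \<comment> \<open>The coefficients of the even part of \<open>h\<close> without the constant
      term; \<open>k - 2\<close> undoes the shift in \<open>b\<close>.\<close>
    define d' where "d' k = (if even k \<and> 2 \<le> k then b (k - 2) else 0)" for k
    have "summable (\<lambda>k. d' k * s ^ k)"
    proof (rule nonneg_power_series_continuation_summable
        [of "V \<inter> uminus ` V" "\<lambda>z. (h z + h (- z)) / 2 - a 0"])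
      \<comment> \<open>The function \<open>h (- z)\<close> is holomorphic where \<open>- z\<close>
        lies in \<open>V\<close>, hence the intersection.\<close>
      have "open (uminus ` V)" by (rule open_negations) (rule V)
      then show "open (V \<inter> uminus ` V)" using V by blast
      show "of_real t \<in> V \<inter> uminus ` V" for t :: real
        using V(2)[of t] V(2)[of "- t"] by (auto intro!: image_eqI[of _ _ "- of_real t"])
      have "h \<circ> uminus holomorphic_on V \<inter> uminus ` V"
        by (intro holomorphic_on_compose_gen[of _ _ _ V] h holomorphic_intros) auto
      then show "(\<lambda>z. (h z + h (- z)) / 2 - a 0) holomorphic_on V \<inter> uminus ` V"
        using h by (intro holomorphic_intros) (auto intro: holomorphic_on_subset simp: o_def)
      show "0 \<le> d' k" for k using even(1)[of "(k - 2) div 2"] by (auto simp: d'_def)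
      fix t :: real assume t: "\<bar>t\<bar> < \<delta>"
      have "(\<lambda>k. if k \<in> {0} then a k * of_real t ^ k else 0) sums (\<Sum>k\<in>{0}. a k * of_real t ^ k)"
        by (rule sums_If_finite_set) simp
      then have s0: "(\<lambda>k. if k \<in> {0} then a k * of_real t ^ k else 0) sums a 0" by simp
      have even_part: "(\<lambda>k. (a k * of_real t ^ k + a k * of_real (- t) ^ k) / 2
          - (if k \<in> {0} then a k * of_real t ^ k else 0))
        sums ((h (of_real t) + h (of_real (- t))) / 2 - a 0)"
        using t by (intro sums_diff sums_divide sums_add sums s0) auto
      have ak: "a k = of_real (b (k - 2))" if "2 \<le> k" for k
        using real[of "k - 2"] by (simp only: le_add_diff_inverse2[OF that])
      have "(a k * of_real t ^ k + a k * of_real (- t) ^ k) / 2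
          - (if k \<in> {0} then a k * of_real t ^ k else 0) = of_real (d' k) * of_real t ^ k" for k
        using ak[of k] by (cases "even k"; cases "k = 0"; cases "k = 1") (auto simp: d'_def)
      with even_part show "(\<lambda>k. of_real (d' k) * complex_of_real t ^ k)
          sums ((h (of_real t) + h (- of_real t)) / 2 - a 0)" by simp
    qed fact
    then have "(\<lambda>k. d' k * s ^ k) \<longlonglongrightarrow> 0" by (rule summable_LIMSEQ_zero)
    then have "((\<lambda>k. d' k * s ^ k) \<circ> (\<lambda>k. 2 * k + 2)) \<longlonglongrightarrow> 0"
      by (rule LIMSEQ_subseq_LIMSEQ) (simp add: strict_mono_def)
    then have "(\<lambda>k. b (2 * k) * s ^ (2 * k + 2)) \<longlonglongrightarrow> 0" by (simp add: o_def d'_def)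
    moreover have "b 0 / \<rho> \<le> b (2 * k) * s ^ (2 * k + 2)" for k
    proof -
      have "s ^ (2 * k + 2) = (1 / \<rho>) ^ Suc k"
      proof -
        have "2 * k + 2 = 2 * Suc k" by simp
        then have "s ^ (2 * k + 2) = (s\<^sup>2) ^ Suc k" by (simp only: power_mult)
        then show ?thesis using \<open>\<rho> > 0\<close> by (simp add: s_def)
      qed
      then have "b 0 / \<rho> = (b 0 * \<rho> ^ k) * s ^ (2 * k + 2)"
        using \<open>\<rho> > 0\<close> by (simp add: field_simps)
      also have "\<dots> \<le> b (2 * k) * s ^ (2 * k + 2)"
        using lower \<open>\<rho> > 0\<close> by (intro mult_right_mono) (auto simp: s_def)
      finally show ?thesis .
    qed
    ultimately have "b 0 / \<rho> \<le> 0" by (intro LIMSEQ_le_const) auto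
    then show False using b0 \<open>\<rho> > 0\<close> by (simp add: divide_le_0_iff)
  qed
  have "a k = 0" if "k \<ge> 3" for k
  proof -
    \<comment> \<open>The minor with indices 1 and \<open>k - 3\<close>; its diagonal entry
      \<open>b 2\<close> has just been shown to vanish.\<close>
    have "b (1 + (k - 3)) = 0" using det[of 1 "k - 3"] \<open>b 2 = 0\<close> by simp
    moreover have "1 + (k - 3) + 2 = k" using that by simp
    ultimately show ?thesis using real[of "1 + (k - 3)"] by simp
  qed
  then have sums2: "(\<lambda>k. a k * z ^ k) sums (a 0 + a 1 * z + a 2 * z\<^sup>2)" for z :: complex
    using sums_finite[of "{..<3}" "\<lambda>k. a k * z ^ k"] by (simp add: eval_nat_numeral)
  let ?T = "range complex_of_real"
  \<comment> \<open>The series is now a quadratic polynomial, but it is tied to \<open>h\<close>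
    only near 0; the identity theorem along the real axis reaches every real
    \<open>t\<close>.\<close>
  obtain C where "?T \<subseteq> C" "\<And>z. z \<in> C \<Longrightarrow> h z = a 0 + a 1 * z + a 2 * z\<^sup>2"
  proof (rule real_line_identity[of V h "\<lambda>z. a 0 + a 1 * z + a 2 * z\<^sup>2" ?T \<delta>])
    show "connected ?T" by (intro connected_continuous_image continuous_intros) auto
    show "h (of_real t) = a 0 + a 1 * of_real t + a 2 * (of_real t)\<^sup>2" if "\<bar>t\<bar> < \<delta>" for t
      using sums[OF that] sums2 by (rule sums_unique2)
    show "(\<lambda>z. a 0 + a 1 * z + a 2 * z\<^sup>2) holomorphic_on V" by (intro holomorphic_intros)
    show "0 \<in> ?T" by (metis of_real_0 rangeI)
  qed (use V h \<open>\<delta> > 0\<close> in auto)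
  then show ?thesis by auto
qed

section \<open>Kronecker products\<close>

text \<open>The second factor takes the inner index, as in \<open>block_mat\<close>. Evaluating a
  polynomial matrix at \<open>kron (X i) A\<close> then yields a Kronecker product with
  \<open>A\<close> powers on the right without permuting indices.\<close>

definition kron :: "complex mat \<Rightarrow> complex mat \<Rightarrow> complex mat" where
  "kron A B = Matrix.mat (dim_row A * dim_row B) (dim_col A * dim_col B)
     (\<lambda>(r, s). A $$ (r div dim_row B, s div dim_col B) * B $$ (r mod dim_row B, s mod dim_col B))"

lemma kron_carrier: "A \<in> carrier_mat n n \<Longrightarrow> B \<in> carrier_mat M M \<Longrightarrow> kron A B \<in> carrier_mat (n * M) (n * M)"
  by (auto simp: kron_def)

lemma kron_index:
  "A \<in> carrier_mat n n \<Longrightarrow> B \<in> carrier_mat M M \<Longrightarrow> r < n * M \<Longrightarrow> s < n * M \<Longrightarrow>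
    kron A B $$ (r, s) = A $$ (r div M, s div M) * B $$ (r mod M, s mod M)"
  by (auto simp: kron_def)

lemma sum_div_mod:
  fixes f :: "nat \<Rightarrow> nat \<Rightarrow> complex"
  shows "(\<Sum>r<n * M. f (r div M) (r mod M)) = (\<Sum>R<n. \<Sum>a<M. f R a)"
proof -
  have "(\<Sum>r<n * M. f (r div M) (r mod M)) = (\<Sum>R<n. \<Sum>r\<in>{R * M..<R * M + M}. f (r div M) (r mod M))"
    by (rule sum.nat_group[symmetric])
  also have "\<dots> = (\<Sum>R<n. \<Sum>a<M. f R a)"
  proof (intro sum.cong[OF refl])
    fix R
    have "(\<Sum>r\<in>{R * M..<R * M + M}. f (r div M) (r mod M)) =
        (\<Sum>a\<in>{0..<M}. f ((a + R * M) div M) ((a + R * M) mod M))"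
      using sum.shift_bounds_nat_ivl[of "\<lambda>r. f (r div M) (r mod M)" 0 "R * M" M] by (simp add: add.commute)
    also have "\<dots> = (\<Sum>a<M. f R a)" by (intro sum.cong) auto
    finally show "(\<Sum>r\<in>{R * M..<R * M + M}. f (r div M) (r mod M)) = (\<Sum>a<M. f R a)" .
  qed
  finally show ?thesis .
qed

lemma mod_less_of_less_mult: "r < n * M \<Longrightarrow> r mod M < M" for r n M :: nat
  by (cases "M = 0") auto

lemma kron_mult:
  assumes "A \<in> carrier_mat n n" "C \<in> carrier_mat n n" "B \<in> carrier_mat M M" "E \<in> carrier_mat M M"
  shows "kron A B * kron C E = kron (A * C) (B * E)"
proof (rule eq_matI)
  have AC: "A * C \<in> carrier_mat n n" and BE: "B * E \<in> carrier_mat M M" using assms by auto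
  fix r s assume "r < dim_row (kron (A * C) (B * E))" "s < dim_col (kron (A * C) (B * E))"
  then have rs: "r < n * M" "s < n * M" using kron_carrier[OF AC BE] by auto
  note d = less_mult_imp_div_less[OF rs(1)] less_mult_imp_div_less[OF rs(2)]
  note m = mod_less_of_less_mult[OF rs(1)] mod_less_of_less_mult[OF rs(2)]
  have "(kron A B * kron C E) $$ (r, s) = (\<Sum>k<n * M. kron A B $$ (r, k) * kron C E $$ (k, s))"
    by (rule index_mult_mat_sum[OF kron_carrier kron_carrier rs]) (use assms in auto)
  also have "\<dots> = (\<Sum>k<n * M. (A $$ (r div M, k div M) * C $$ (k div M, s div M)) *
      (B $$ (r mod M, k mod M) * E $$ (k mod M, s mod M)))"
    using rs by (intro sum.cong) (auto simp: kron_index[OF assms(1,3)] kron_index[OF assms(2,4)])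
  also have "\<dots> = (\<Sum>K<n. \<Sum>k<M. (A $$ (r div M, K) * C $$ (K, s div M)) *
      (B $$ (r mod M, k) * E $$ (k, s mod M)))"
    by (rule sum_div_mod)
  also have "\<dots> = kron (A * C) (B * E) $$ (r, s)"
    unfolding kron_index[OF AC BE rs] index_mult_mat_sum[OF assms(1,2) d]
      index_mult_mat_sum[OF assms(3,4) m] sum_product ..
  finally show "(kron A B * kron C E) $$ (r, s) = kron (A * C) (B * E) $$ (r, s)" .
qed (use assms in \<open>auto simp: kron_def\<close>)

lemma kron_one: "M > 0 \<Longrightarrow> kron (1\<^sub>m n) (1\<^sub>m M) = 1\<^sub>m (n * M)"
proof (rule eq_matI)
  fix r s assume M: "M > 0" and "r < dim_row (1\<^sub>m (n * M) :: complex mat)" "s < dim_col (1\<^sub>m (n * M) :: complex mat)"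
  then have rs: "r < n * M" "s < n * M" by auto
  have "r = s \<longleftrightarrow> r div M = s div M \<and> r mod M = s mod M" by (metis div_mult_mod_eq)
  then show "kron (1\<^sub>m n) (1\<^sub>m M) $$ (r, s) = 1\<^sub>m (n * M) $$ (r, s)"
    using rs less_mult_imp_div_less[OF rs(1)] less_mult_imp_div_less[OF rs(2)]
      mod_less_of_less_mult[OF rs(1)] mod_less_of_less_mult[OF rs(2)]
    by (auto simp: kron_def)
qed (auto simp: kron_def)

lemma pow_mat_left: "A \<in> carrier_mat n n \<Longrightarrow> A * A ^\<^sub>m k = A ^\<^sub>m Suc k"
proof (induction k)
  case (Suc k)
  then have "A * (A ^\<^sub>m k * A) = (A * A ^\<^sub>m k) * A"
    by (intro assoc_mult_mat[symmetric, of A n n _ n _ n]) auto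
  with Suc show ?case by simp
qed auto

lemma pow_mat_smult:
  "A \<in> carrier_mat n n \<Longrightarrow> (c \<cdot>\<^sub>m A) ^\<^sub>m k = c ^ k \<cdot>\<^sub>m A ^\<^sub>m k" for c :: complex
proof (induction k)
  case 0 then show ?case by (auto intro: eq_matI)
next
  case (Suc k)
  note A = Suc.prems
  have Ak: "A ^\<^sub>m k \<in> carrier_mat n n" using A by simp
  have "c ^ k \<cdot>\<^sub>m A ^\<^sub>m k * (c \<cdot>\<^sub>m A) = c ^ Suc k \<cdot>\<^sub>m (A ^\<^sub>m k * A)"
    unfolding mult_smult_assoc_mat[OF Ak smult_carrier_mat[OF A]] mult_smult_distrib[OF Ak A]
    by (intro eq_matI) (auto simp: mult_ac)
  then show ?case using Suc by simp
qed

section \<open>Evaluation of nc polynomials at Kronecker products\<close>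

lemma word_eval_carrier: "X \<in> mat_tuples n \<Longrightarrow> word_eval n X w \<in> carrier_mat n n"
  by (induction w) (auto simp: word_eval_def mat_tuples_def intro!: mult_carrier_mat)

text \<open>By the mixed product rule each letter contributes one factor \<open>A\<close>, so a word
  sees \<open>A\<close> only through its length. For a homogeneous polynomial all words share the
  same power, which factors out.\<close>

lemma word_eval_kron:
  assumes X: "X \<in> mat_tuples n" and A: "A \<in> carrier_mat M M" and "M > 0"
  shows "word_eval (n * M) (\<lambda>i. kron (X i) A) w = kron (word_eval n X w) (A ^\<^sub>m length w)"
proof (induction w)
  case Nil
  then show ?case using \<open>M > 0\<close> A by (simp add: word_eval_def kron_one)
next
  case (Cons i w)
  have "word_eval (n * M) (\<lambda>i. kron (X i) A) (i # w) = kron (X i) A * kron (word_eval n X w) (A ^\<^sub>m length w)"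
    using Cons by (simp add: word_eval_def)
  also have "\<dots> = kron (X i * word_eval n X w) (A * A ^\<^sub>m length w)"
    using X by (intro kron_mult[of _ n _ _ M] word_eval_carrier[OF X] A pow_carrier_mat)
      (auto simp: mat_tuples_def)
  finally show ?case using pow_mat_left[OF A] by (simp add: word_eval_def)
qed

lemma nc_eval_kron:
  assumes X: "X \<in> mat_tuples n" and A: "A \<in> carrier_mat M M" and "M > 0"
    and p: "\<forall>w \<in> Poly_Mapping.keys p. length w = k"
  shows "nc_eval (n * M) (\<lambda>i. kron (X i) A) p = kron (nc_eval n X p) (A ^\<^sub>m k)"
proof (rule eq_matI)
  have Ak: "A ^\<^sub>m k \<in> carrier_mat M M" using A by simp
  have nc: "nc_eval n X p \<in> carrier_mat n n" by (simp add: nc_eval_def)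
  fix r s assume "r < dim_row (kron (nc_eval n X p) (A ^\<^sub>m k))" "s < dim_col (kron (nc_eval n X p) (A ^\<^sub>m k))"
  then have rs: "r < n * M" "s < n * M" using kron_carrier[OF nc Ak] by auto
  have "word_eval (n * M) (\<lambda>i. kron (X i) A) w $$ (r, s) =
      word_eval n X w $$ (r div M, s div M) * (A ^\<^sub>m k) $$ (r mod M, s mod M)"
    if "w \<in> Poly_Mapping.keys p" for w
    using that p kron_index[OF word_eval_carrier[OF X] Ak rs] by (simp add: word_eval_kron[OF X A \<open>M > 0\<close>])
  then show "nc_eval (n * M) (\<lambda>i. kron (X i) A) p $$ (r, s) = kron (nc_eval n X p) (A ^\<^sub>m k) $$ (r, s)"
    using rs less_mult_imp_div_less[OF rs(1)] less_mult_imp_div_less[OF rs(2)]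
    by (simp add: kron_index[OF nc Ak rs]) (simp add: nc_eval_def sum_distrib_right mult.assoc)
qed (use A in \<open>auto simp: kron_def nc_eval_def\<close>)

lemma poly_eval_carrier: "P \<in> carrier_mat m m \<Longrightarrow> poly_eval n P X \<in> carrier_mat (m * n) (m * n)"
  by (auto simp: poly_eval_def block_mat_def)

lemma poly_eval_index:
  assumes "P \<in> carrier_mat m m" "r < m * n" "s < m * n"
  shows "poly_eval n P X $$ (r, s) = nc_eval n X (P $$ (r div n, s div n)) $$ (r mod n, s mod n)"
  using assms less_mult_imp_div_less[OF assms(2)] less_mult_imp_div_less[OF assms(3)]
  by (auto simp: poly_eval_def block_mat_def)

text \<open>An index splits into three parts, for the entry of \<open>P\<close>, of the tuple and of
  \<open>A\<close>; splitting first at \<open>n * M\<close> or first at \<open>M\<close> gives the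
  same parts.\<close>

lemma poly_eval_kron:
  assumes X: "X \<in> mat_tuples n" and A: "A \<in> carrier_mat M M" and "M > 0"
    and P: "homogeneous_poly m k P"
  shows "poly_eval (n * M) P (\<lambda>i. kron (X i) A) = kron (poly_eval n P X) (A ^\<^sub>m k)"
proof (rule eq_matI)
  have Pc: "P \<in> carrier_mat m m" using P by (simp add: homogeneous_poly_def)
  have Ak: "A ^\<^sub>m k \<in> carrier_mat M M" using A by simp
  note pc = poly_eval_carrier[OF Pc, of n X]
  fix r s assume "r < dim_row (kron (poly_eval n P X) (A ^\<^sub>m k))" "s < dim_col (kron (poly_eval n P X) (A ^\<^sub>m k))"
  then have rs: "r < m * n * M" "s < m * n * M" using kron_carrier[OF pc Ak] by auto
  then have rs': "r < m * (n * M)" "s < m * (n * M)" by (auto simp: mult.assoc)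
  have d: "r div M < m * n" "s div M < m * n" using rs by (auto intro: less_mult_imp_div_less)
  have dd: "r div M div n < m" "s div M div n < m" using d by (auto intro: less_mult_imp_div_less)
  have mm: "r mod (n * M) < n * M" "s mod (n * M) < n * M" using rs' by (auto intro: mod_less_of_less_mult)
  have div: "q div (n * M) = q div M div n" for q by (simp add: div_mult2_eq mult.commute)
  have mod: "q mod (n * M) div M = q div M mod n" "q mod (n * M) mod M = q mod M" for q
    using \<open>M > 0\<close> by (auto simp: mod_mult2_eq mult.commute[of n])
  have nc: "nc_eval n X p \<in> carrier_mat n n" for p by (simp add: nc_eval_def)
  have h: "\<forall>w \<in> Poly_Mapping.keys (P $$ (r div M div n, s div M div n)). length w = k"
    using P dd by (auto simp: homogeneous_poly_def)
  show "poly_eval (n * M) P (\<lambda>i. kron (X i) A) $$ (r, s) = kron (poly_eval n P X) (A ^\<^sub>m k) $$ (r, s)"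
    unfolding poly_eval_index[OF Pc rs'] kron_index[OF pc Ak rs] poly_eval_index[OF Pc d] div
      nc_eval_kron[OF X A \<open>M > 0\<close> h] kron_index[OF nc Ak mm] mod ..
qed (use A P in \<open>auto simp: kron_def poly_eval_def block_mat_def homogeneous_poly_def\<close>)

text \<open>On product vectors the form factors, so a fixed \<open>u\<close> turns matrix
  coefficients into scalar ones.\<close>

lemma quad_form_kron:
  assumes "P \<in> carrier_mat d d" "Q \<in> carrier_mat M M"
  shows "quad_form (d * M) (kron P Q) (\<lambda>r. u (r div M) * v (r mod M)) = quad_form d P u * quad_form M Q v"
proof -
  have "quad_form (d * M) (kron P Q) (\<lambda>r. u (r div M) * v (r mod M)) =
    (\<Sum>r<d * M. \<Sum>s<d * M. cnj (u (r div M) * v (r mod M)) *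
      (P $$ (r div M, s div M) * Q $$ (r mod M, s mod M)) * (u (s div M) * v (s mod M)))"
    unfolding quad_form_def using kron_index[OF assms] by (intro sum.cong) auto
  also have "\<dots> = (\<Sum>R<d. \<Sum>a<M. \<Sum>S<d. \<Sum>b<M. cnj (u R * v a) * (P $$ (R, S) * Q $$ (a, b)) * (u S * v b))"
    by (subst sum_div_mod[symmetric], subst sum_div_mod[symmetric]) (rule refl)
  also have "\<dots> = (\<Sum>R<d. \<Sum>S<d. \<Sum>a<M. \<Sum>b<M. (cnj (u R) * P $$ (R, S) * u S) * (cnj (v a) * Q $$ (a, b) * v b))"
    by (rule sum.cong[OF refl], subst sum.swap, intro sum.cong refl) (simp add: mult_ac)
  also have "\<dots> = (\<Sum>R<d. \<Sum>S<d. (cnj (u R) * P $$ (R, S) * u S) * quad_form M Q v)"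
    by (simp only: quad_form_def sum_distrib_left)
  also have "\<dots> = quad_form d P u * quad_form M Q v"
    by (simp only: quad_form_def[of d] sum_distrib_right)
  finally show ?thesis .
qed

lemma quad_form_smult: "A \<in> carrier_mat n n \<Longrightarrow> quad_form n (c \<cdot>\<^sub>m A) v = c * quad_form n A v"
  by (auto simp: quad_form_def sum_distrib_left mult_ac intro!: sum.cong)

lemma quad_form_add:
  "A \<in> carrier_mat n n \<Longrightarrow> B \<in> carrier_mat n n \<Longrightarrow> quad_form n (A + B) v = quad_form n A v + quad_form n B v"
  unfolding quad_form_def sum.distrib[symmetric]
  by (intro sum.cong refl) (auto simp: algebra_simps)

lemma quad_form_minus:
  "A \<in> carrier_mat n n \<Longrightarrow> B \<in> carrier_mat n n \<Longrightarrow> quad_form n (A - B) v = quad_form n A v - quad_form n B v"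
  unfolding quad_form_def sum_subtractf[symmetric]
  by (intro sum.cong refl) (auto simp: algebra_simps)

lemma kron_herm_tuples:
  assumes X: "X \<in> herm_tuples n" and A: "A \<in> carrier_mat M M" "mat_adjoint A = A"
  shows "(\<lambda>i. kron (X i) A) \<in> herm_tuples (n * M)"
proof -
  have Xc: "X i \<in> carrier_mat n n" "mat_adjoint (X i) = X i" for i
    using X by (auto simp: herm_tuples_def mat_tuples_def)
  have "mat_adjoint (kron (X i) A) = kron (X i) A" for i
  proof (rule eq_matI)
    note kc = kron_carrier[OF Xc(1)[of i] A(1)]
    fix r s assume "r < dim_row (kron (X i) A)" "s < dim_col (kron (X i) A)"
    then have rs: "r < n * M" "s < n * M" using kc by auto
    have "cnj (X i $$ (s div M, r div M)) = X i $$ (r div M, s div M)"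
      using mat_adjoint_index[of "r div M" "X i" "s div M"] Xc(2)[of i] carrier_matD[OF Xc(1)[of i]]
        rs by (simp add: less_mult_imp_div_less)
    moreover have "cnj (A $$ (s mod M, r mod M)) = A $$ (r mod M, s mod M)"
      using mat_adjoint_index[of "r mod M" A "s mod M"] A rs by (auto simp: mod_less_of_less_mult)
    ultimately show "mat_adjoint (kron (X i) A) $$ (r, s) = kron (X i) A $$ (r, s)"
      using kc rs by (simp add: mat_adjoint_index kron_index[OF Xc(1) A(1)])
  qed (use kron_carrier[OF Xc(1)[of i] A(1)] mat_adjoint_carrier in auto)
  then show ?thesis using kron_carrier[OF Xc(1) A(1)] by (auto simp: herm_tuples_def mat_tuples_def)
qed

lemma scale_tuple_kron:
  "X \<in> mat_tuples n \<Longrightarrow> A \<in> carrier_mat M M \<Longrightarrow>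
    scale_tuple c (\<lambda>i. kron (X i) A) = (\<lambda>i. kron (X i) (c \<cdot>\<^sub>m A))"
  by (auto simp: scale_tuple_def mat_tuples_def kron_def fun_eq_iff carrier_matD[of "X _" n n]
      mod_less_of_less_mult intro!: eq_matI)

lemma kron_one_right: "A \<in> carrier_mat n n \<Longrightarrow> kron A (1\<^sub>m (Suc 0)) = A"
  by (rule eq_matI) (auto simp: kron_def)

section \<open>Powers of path matrices\<close>

text \<open>The weighted adjacency matrix of the path on the nodes below \<open>M\<close>, where
  \<open>c\<close> weights the edge between 0 and 1. The values of interest are 1 (the path), 0
  (node 0 isolated) and -1 (the path after a sign flip at node 0).\<close>

definition path_mat :: "nat \<Rightarrow> real \<Rightarrow> complex mat" where
  "path_mat M c = Matrix.mat M M (\<lambda>(a, b). if a = Suc b \<or> b = Suc a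
     then (if a = 0 \<or> b = 0 then complex_of_real c else 1) else 0)"

lemma path_mat_carrier: "path_mat M c \<in> carrier_mat M M"
  by (simp add: path_mat_def)

lemma path_mat_hermitian: "mat_adjoint (path_mat M c) = path_mat M c"
  using mat_adjoint_carrier[OF path_mat_carrier, of M c]
  by (intro eq_matI) (auto simp: mat_adjoint_index path_mat_def)

text \<open>Splits off the last edge of a walk; with the starting node fixed, this recursion drives
  the inductions on powers.\<close>

lemma path_mat_pow_Suc:
  assumes "a < M" "b < M"
  shows "(path_mat M c ^\<^sub>m Suc k) $$ (a, b) =
    (if b = 0 then 0 else (path_mat M c ^\<^sub>m k) $$ (a, b - 1) * (if b = 1 then complex_of_real c else 1)) +
    (if Suc b < M then (path_mat M c ^\<^sub>m k) $$ (a, Suc b) * (if b = 0 then complex_of_real c else 1) else 0)"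
proof -
  let ?P = "\<lambda>r. (path_mat M c ^\<^sub>m k) $$ (a, r)"
  have "(path_mat M c ^\<^sub>m Suc k) $$ (a, b) = (\<Sum>r<M. ?P r * path_mat M c $$ (r, b))"
    using index_mult_mat_sum[OF pow_carrier_mat[OF path_mat_carrier] path_mat_carrier assms] by simp
  also have "\<dots> = (\<Sum>r<M. (if r = b - 1 then (if b = 0 then 0 else ?P r * (if b = 1 then complex_of_real c else 1)) else 0)
      + (if r = Suc b then ?P r * (if b = 0 then complex_of_real c else 1) else 0))"
    using assms by (intro sum.cong) (auto simp: path_mat_def)
  also have "\<dots> = (if b = 0 then 0 else ?P (b - 1) * (if b = 1 then complex_of_real c else 1)) +
    (if Suc b < M then ?P (Suc b) * (if b = 0 then complex_of_real c else 1) else 0)"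
    using assms by (simp add: sum.distrib)
  finally show ?thesis .
qed

lemma path_mat_pow_0: "a < M \<Longrightarrow> b < M \<Longrightarrow> (path_mat M c ^\<^sub>m 0) $$ (a, b) = (if a = b then 1 else 0)"
  by (simp add: path_mat_def)

text \<open>Conjugation by diag(-1, 1, ..., 1) changes \<open>c\<close> to \<open>- c\<close>, which
  shows as one sign for each end of the walk at node 0.\<close>

lemma path_mat_pow_flip:
  "a < M \<Longrightarrow> b < M \<Longrightarrow> (path_mat M (- c) ^\<^sub>m k) $$ (a, b) =
    (if a = 0 then - 1 else 1) * (if b = 0 then - 1 else 1) * (path_mat M c ^\<^sub>m k) $$ (a, b)"
proof (induction k arbitrary: b)
  case 0
  then show ?case by (simp only: path_mat_pow_0) simp
next
  case (Suc k)
  then show ?case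
    by (cases "b = 0"; cases "b = 1"; cases "Suc b < M")
      (simp_all only: path_mat_pow_Suc, auto simp: less_imp_diff_less)
qed

text \<open>The nodes are \<open>a - b\<close> steps apart: fewer steps never suffice, and with
  exactly that many only the straight walk exists.\<close>

lemma path_mat_pow_short:
  "a < M \<Longrightarrow> k + b \<le> a \<Longrightarrow> (path_mat M 1 ^\<^sub>m k) $$ (a, b) = (if k + b = a then 1 else 0)"
proof (induction k arbitrary: b)
  case 0
  then show ?case by (simp only: path_mat_pow_0) simp
next
  case (Suc k)
  have "a < M" "b < M" "Suc b < M" using Suc.prems by auto
  then show ?case using Suc.IH[of "b - 1"] Suc.IH[of "Suc b"] Suc.prems
    by (cases "b = 0") (simp_all only: path_mat_pow_Suc, auto)
qed

text \<open>A walk on the path that distinguishes the two matrices has to visit node 0.\<close>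

lemma path_mat_pow_diff:
  "a < M \<Longrightarrow> b < M \<Longrightarrow> 0 < a \<Longrightarrow> 0 < b \<Longrightarrow> k \<le> a + b \<Longrightarrow>
    (path_mat M 1 ^\<^sub>m k) $$ (a, b) - (path_mat M 0 ^\<^sub>m k) $$ (a, b) = (if k = a + b then 1 else 0)"
proof (induction k arbitrary: b)
  case 0
  then show ?case by (simp only: path_mat_pow_0) simp
next
  case (Suc k)
  let ?D = "\<lambda>k b. (path_mat M 1 ^\<^sub>m k) $$ (a, b) - (path_mat M 0 ^\<^sub>m k) $$ (a, b)"
  \<comment> \<open>A walk to node \<open>b + 1\<close> that visits node 0 has at least
    \<open>a + b + 1\<close> steps, but \<open>k \<le> a + b - 1\<close>.\<close>
  have up: "?D k (Suc b) = 0" if "Suc b < M" using Suc that by simp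
  show ?case
  proof (cases "b = 1")
    case True
    \<comment> \<open>Only the step from 0 to 1 differs between the matrices: it survives for
      \<open>c = 1\<close> and leaves the walks from \<open>a\<close> to 0 of length
      \<open>k \<le> a\<close>.\<close>
    then have "?D (Suc k) b = (path_mat M 1 ^\<^sub>m k) $$ (a, 0) + (if Suc b < M then ?D k (Suc b) else 0)"
      using Suc.prems by (simp only: path_mat_pow_Suc) simp
    then show ?thesis using True Suc.prems up path_mat_pow_short[of a M k 0] by simp
  next
    case False
    then have "?D (Suc k) b = ?D k (b - 1) + (if Suc b < M then ?D k (Suc b) else 0)"
      using Suc.prems by (simp only: path_mat_pow_Suc) simp
    then show ?thesis using False Suc.prems up Suc.IH[of "b - 1"] by (auto simp: less_imp_diff_less)
  qed
qed

text \<open>Every node has at most two neighbours, and all weights have modulus at most 1.\<close>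

lemma path_mat_pow_bound:
  assumes "\<bar>c\<bar> \<le> 1"
  shows "a < M \<Longrightarrow> b < M \<Longrightarrow> cmod ((path_mat M c ^\<^sub>m k) $$ (a, b)) \<le> 2 ^ k"
proof (induction k arbitrary: b)
  case 0
  then show ?case by (simp only: path_mat_pow_0) simp
next
  case (Suc k)
  let ?P = "\<lambda>r. (path_mat M c ^\<^sub>m k) $$ (a, r)"
  have step: "cmod (?P r * (if q then complex_of_real c else 1)) \<le> 2 ^ k" if "r < M" for r q
    using Suc.IH[OF Suc.prems(1) that] mult_mono[of "cmod (?P r)" "2 ^ k" "\<bar>c\<bar>" 1] assms
    by (auto simp: norm_mult)
  have "cmod ((path_mat M c ^\<^sub>m Suc k) $$ (a, b)) \<le> 2 ^ k + 2 ^ k"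
    unfolding path_mat_pow_Suc[OF Suc.prems]
    by (rule norm_triangle_mono) (use step Suc.prems in \<open>auto simp: less_imp_diff_less\<close>)
  then show ?case by simp
qed

lemma quad_form_path_mat_pow_flip:
  assumes "v 0 = 0"
  shows "quad_form M (path_mat M (- c) ^\<^sub>m k) v = quad_form M (path_mat M c ^\<^sub>m k) v"
  unfolding quad_form_def using assms by (intro sum.cong) (auto simp: path_mat_pow_flip)

section \<open>Power series with geometrically bounded weights\<close>

text \<open>The terms \<open>a k * of_real t ^ k\<close> are bounded, so the weights
  \<open>D k\<close> shrink the region of convergence by at most the factor
  \<open>B\<close>.\<close>

lemma summable_mult_geometric_bound:
  fixes a D :: "nat \<Rightarrow> complex"
  assumes "t > 0" and a: "summable (\<lambda>k. a k * of_real t ^ k)"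
    and D: "\<And>k. cmod (D k) \<le> K * B ^ k" and "B > 0" and z: "cmod z < t / B"
  shows "summable (\<lambda>k. a k * z ^ k * D k)"
proof -
  obtain C where C: "\<And>k. cmod (a k * of_real t ^ k) \<le> C"
    using summable_imp_Bseq[OF a] by (meson BseqE)
  have "K \<ge> 0" using order_trans[OF norm_ge_zero D[of 0]] by simp
  have "C \<ge> 0" using order_trans[OF norm_ge_zero C[of 0]] .
  have "cmod z * B / t < 1" using z \<open>t > 0\<close> \<open>B > 0\<close> by (simp add: field_simps)
  then have "summable (\<lambda>k. C * K * (cmod z * B / t) ^ k)"
    using \<open>t > 0\<close> \<open>B > 0\<close> by (intro summable_mult summable_geometric) simp
  moreover have "cmod (a k * z ^ k * D k) \<le> C * K * (cmod z * B / t) ^ k" for k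
  proof -
    have "cmod (a k * z ^ k * D k) = cmod (a k * of_real t ^ k) * cmod (D k) * (cmod z / t) ^ k"
      using \<open>t > 0\<close> by (simp add: norm_mult norm_power power_divide)
    also have "\<dots> \<le> C * (K * B ^ k) * (cmod z / t) ^ k"
      using C D \<open>t > 0\<close> \<open>B > 0\<close> \<open>C \<ge> 0\<close> \<open>K \<ge> 0\<close> by (intro mult_mono mult_nonneg_nonneg) auto
    finally show ?thesis by (simp add: power_mult_distrib power_divide mult_ac)
  qed
  ultimately show ?thesis by (rule summable_comparison_test')
qed

text \<open>The first \<open>p\<close> terms vanish, so dividing by the \<open>p\<close>-th power
  leaves a power series, continuous at 0. Convexity controls only sums; this reads a single
  coefficient off them.\<close>

lemma power_series_leading_coeff:
  fixes a D :: "nat \<Rightarrow> complex" and f :: "real \<Rightarrow> complex"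
  assumes "t > 0" and a: "summable (\<lambda>k. a k * of_real t ^ k)"
    and D0: "\<And>k. k < p \<Longrightarrow> D k = 0" and D: "\<And>k. cmod (D k) \<le> K * B ^ k" and "B > 0"
    and f: "eventually (\<lambda>s. (\<lambda>k. a k * of_real s ^ k * D k) sums f s) (at_right 0)"
  shows "((\<lambda>s. f s / of_real s ^ p) \<longlongrightarrow> a p * D p) (at_right 0)"
proof -
  have summ: "summable (\<lambda>k. a k * D k * z ^ k)" if "cmod z < t / B" for z
    using summable_mult_geometric_bound[OF \<open>t > 0\<close> a D \<open>B > 0\<close> that] by (simp add: mult_ac)
  define c where "c k = a (k + p) * D (k + p)" for k
  define g where "g z = suminf (\<lambda>k. c k * z ^ k)" for z
  have g: "(\<lambda>k. c k * z ^ k) sums g z" if z: "cmod z < t / B" for z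
  proof -
    have "summable (\<lambda>k. c k * z ^ k)"
    proof (cases "z = 0")
      case False
      have "summable (\<lambda>k. a (k + p) * D (k + p) * z ^ (k + p))"
        using summ[OF z] by (subst summable_iff_shift)
      then have "summable (\<lambda>k. a (k + p) * D (k + p) * z ^ (k + p) * (1 / z ^ p))" by (rule summable_mult2)
      then show ?thesis using False by (simp add: c_def power_add mult.assoc)
    qed (use summable_finite[of "{0}" "\<lambda>k. c k * z ^ k"] in \<open>auto simp: power_0_left\<close>)
    then show ?thesis by (simp add: g_def summable_sums)
  qed
  have "g \<midarrow>0\<rightarrow> c 0" by (rule powser_limit_0[OF _ g]) (use \<open>t > 0\<close> \<open>B > 0\<close> in auto)
  then have "((\<lambda>s. g (complex_of_real s)) \<longlongrightarrow> c 0) (at_right 0)"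
    by (rule filterlim_compose)
      (auto simp: filterlim_at eventually_at_filter intro!: tendsto_eq_intros)
  moreover have "eventually (\<lambda>s. g (of_real s) = f s / of_real s ^ p) (at_right 0)"
  proof -
    have "eventually (\<lambda>s. 0 < s \<and> s < t / B) (at_right 0)"
      using \<open>t > 0\<close> \<open>B > 0\<close> by (auto simp: eventually_at_right_field intro!: exI[of _ "t / B"])
    then show ?thesis using f
    proof eventually_elim
      case (elim s)
      from elim have "(\<lambda>k. a (k + p) * of_real s ^ (k + p) * D (k + p)) sums f s"
        using D0 by (subst sums_iff_shift) simp
      moreover have "(\<lambda>k. c k * of_real s ^ k * of_real s ^ p) sums (g (of_real s) * of_real s ^ p)"
        using elim by (intro sums_mult2 g) auto
      ultimately have "g (of_real s) * of_real s ^ p = f s"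
        by (simp add: c_def power_add mult_ac sums_iff)
      then show "g (of_real s) = f s / of_real s ^ p" using elim by (simp add: field_simps)
    qed
  qed
  ultimately show "((\<lambda>s. f s / of_real s ^ p) \<longlongrightarrow> a p * D p) (at_right 0)"
    by (simp add: c_def tendsto_cong)
qed

section \<open>Reduction to one variable\<close>

lemma scale_tuple_in_polydisc:
  fixes X :: "('g :: finite) tuple"
  assumes X: "X \<in> mat_tuples n" and "r > 0"
  shows "\<exists>\<rho>>0. \<forall>z. cmod (z - z0) < \<rho> \<longrightarrow> scale_tuple z X \<in> polydisc n (scale_tuple z0 X) r"
proof -
  have fin: "finite (coords n :: ('g \<times> nat \<times> nat) set)" by (simp add: coords_def)
  define B where "B = 1 + (\<Sum>k\<in>coords n. cmod (coord X k))"
  have "B > 0" by (simp add: B_def add_pos_nonneg sum_nonneg)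
  have "scale_tuple z X \<in> polydisc n (scale_tuple z0 X) r" if z: "cmod (z - z0) < r / B" for z
  proof -
    have "cmod (coord (scale_tuple z X) k - coord (scale_tuple z0 X) k) < r" if k: "k \<in> coords n" for k
    proof -
      have "coord (scale_tuple w X) k = w * coord X k" for w
        using k X by (auto simp: coord_def scale_tuple_def coords_def mat_tuples_def carrier_matD[of "X _" n n])
      then have "cmod (coord (scale_tuple z X) k - coord (scale_tuple z0 X) k) = cmod (z - z0) * cmod (coord X k)"
        by (simp add: left_diff_distrib[symmetric] norm_mult)
      also have "\<dots> \<le> cmod (z - z0) * B"
        using member_le_sum[OF k, of "\<lambda>k. cmod (coord X k)"] fin
        by (intro mult_left_mono) (auto simp: B_def)
      also have "\<dots> < r" using z \<open>B > 0\<close> by (simp add: pos_less_divide_eq)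
      finally show ?thesis .
    qed
    then show ?thesis using scale_tuple_mat_tuples[OF X] by (simp add: polydisc_def)
  qed
  then show ?thesis using \<open>r > 0\<close> \<open>B > 0\<close> by (intro exI[of _ "r / B"]) auto
qed

text \<open>Coordinates are linear in \<open>z\<close> along the line, so grouping multi-indices by
  total degree turns the unconditionally convergent expansion into a power series in
  \<open>z - z0\<close>.\<close>

lemma analytic_at_line:
  fixes f :: "('g :: finite) tuple \<Rightarrow> complex"
  assumes f: "analytic_at n f (scale_tuple z0 X)" and X: "X \<in> mat_tuples n"
  shows "(\<lambda>z. f (scale_tuple z X)) field_differentiable (at z0)"
proof -
  let ?C = "coords n :: ('g \<times> nat \<times> nat) set"
  let ?A = "?C \<rightarrow>\<^sub>E (UNIV :: nat set)"
  have fin: "finite ?C" by (simp add: coords_def)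
  obtain r c where "r > 0" and c: "\<And>W. W \<in> polydisc n (scale_tuple z0 X) r \<Longrightarrow>
     ((\<lambda>\<alpha>. c \<alpha> * (\<Prod>k\<in>?C. (coord W k - coord (scale_tuple z0 X) k) ^ \<alpha> k)) has_sum f W) ?A"
    using f unfolding analytic_at_def by blast
  obtain \<rho> where "\<rho> > 0" and \<rho>: "\<And>z. cmod (z - z0) < \<rho> \<Longrightarrow> scale_tuple z X \<in> polydisc n (scale_tuple z0 X) r"
    using scale_tuple_in_polydisc[OF X \<open>r > 0\<close>] by blast
  define e where "e \<alpha> = c \<alpha> * (\<Prod>k\<in>?C. coord X k ^ \<alpha> k)" for \<alpha>
  define deg where "deg \<alpha> = (\<Sum>k\<in>?C. \<alpha> k)" for \<alpha> :: "'g \<times> nat \<times> nat \<Rightarrow> nat"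
  define fib where "fib d = {\<alpha> \<in> ?A. deg \<alpha> = d}" for d
  \<comment> \<open>A multi-index of degree \<open>d\<close> has all entries at most
    \<open>d\<close>, so the inner sums of the regrouping are finite.\<close>
  have fin_fib: "finite (fib d)" for d
  proof (rule finite_subset)
    show "fib d \<subseteq> ?C \<rightarrow>\<^sub>E {..d}"
    proof
      fix \<alpha> assume \<alpha>: "\<alpha> \<in> fib d"
      have "\<alpha> k \<le> d" if "k \<in> ?C" for k
        using member_le_sum[OF that, of \<alpha>] fin \<alpha> by (simp add: fib_def deg_def)
      with \<alpha> show "\<alpha> \<in> ?C \<rightarrow>\<^sub>E {..d}" by (auto simp: fib_def PiE_iff)
    qed
    show "finite (?C \<rightarrow>\<^sub>E {..d})" using fin by (intro finite_PiE) auto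
  qed
  have "(\<lambda>d. (\<Sum>\<alpha>\<in>fib d. e \<alpha>) * (z - z0) ^ d) sums f (scale_tuple z X)" if z: "cmod (z - z0) < \<rho>" for z
  proof -
    have term_eq: "c \<alpha> * (\<Prod>k\<in>?C. (coord (scale_tuple z X) k - coord (scale_tuple z0 X) k) ^ \<alpha> k) =
        e \<alpha> * (z - z0) ^ deg \<alpha>" for \<alpha>
    proof -
      have "coord (scale_tuple w X) k = w * coord X k" if "k \<in> ?C" for w k
        using that X by (auto simp: coord_def scale_tuple_def coords_def mat_tuples_def carrier_matD[of "X _" n n])
      then have "(\<Prod>k\<in>?C. (coord (scale_tuple z X) k - coord (scale_tuple z0 X) k) ^ \<alpha> k) =
          (\<Prod>k\<in>?C. (z - z0) ^ \<alpha> k * coord X k ^ \<alpha> k)"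
        by (intro prod.cong) (auto simp: left_diff_distrib[symmetric] power_mult_distrib)
      then show ?thesis by (simp add: e_def deg_def prod.distrib power_sum mult_ac)
    qed
    have "((\<lambda>\<alpha>. e \<alpha> * (z - z0) ^ deg \<alpha>) has_sum f (scale_tuple z X)) ?A"
      using c[OF \<rho>[OF z]] unfolding term_eq .
    moreover have "bij_betw snd (Sigma UNIV fib) ?A"
      by (rule bij_betw_byWitness[of _ "\<lambda>\<alpha>. (deg \<alpha>, \<alpha>)"]) (auto simp: fib_def)
    ultimately have "((\<lambda>p. e (snd p) * (z - z0) ^ deg (snd p)) has_sum f (scale_tuple z X)) (Sigma UNIV fib)"
      by (subst has_sum_reindex_bij_betw[of snd _ ?A "\<lambda>\<alpha>. e \<alpha> * (z - z0) ^ deg \<alpha>"])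
    then have "((\<lambda>d. \<Sum>\<alpha>\<in>fib d. e \<alpha> * (z - z0) ^ deg \<alpha>) has_sum f (scale_tuple z X)) UNIV"
      by (rule has_sum_SigmaD) (auto intro!: has_sum_finite fin_fib)
    then have "(\<lambda>d. \<Sum>\<alpha>\<in>fib d. e \<alpha> * (z - z0) ^ deg \<alpha>) sums f (scale_tuple z X)"
      by (rule has_sum_imp_sums)
    moreover have "(\<Sum>\<alpha>\<in>fib d. e \<alpha> * (z - z0) ^ deg \<alpha>) = (\<Sum>\<alpha>\<in>fib d. e \<alpha>) * (z - z0) ^ d" for d
      unfolding sum_distrib_right by (intro sum.cong) (auto simp: fib_def)
    ultimately show ?thesis by simp
  qed
  then have "(\<lambda>z. f (scale_tuple z X)) holomorphic_on ball z0 \<rho>"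
    by (intro power_series_holomorphic) (auto simp: dist_norm norm_minus_commute)
  then show ?thesis using \<open>\<rho> > 0\<close>
    by (meson holomorphic_on_imp_differentiable_at open_ball centre_in_ball)
qed

section \<open>The scalar series of a tuple and a vector\<close>

lemma fun_eval_carrier: "F \<in> carrier_mat m m \<Longrightarrow> fun_eval n F X \<in> carrier_mat (m * n) (m * n)"
  by (auto simp: fun_eval_def block_mat_def)

lemma quad_form_sums:
  assumes "mat_sums A S" "S \<in> carrier_mat d d"
  shows "(\<lambda>k. quad_form d (A k) v) sums quad_form d S v"
  unfolding quad_form_def using assms
  by (intro sums_sum sums_mult sums_mult2) (auto simp: mat_sums_def)

text \<open>The series has the same coefficients \<open>Fs\<close> at every size, so it may be read
  at size \<open>n * M\<close>; there it becomes a scalar series in powers of \<open>s\<close> and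
  \<open>A\<close>, with coefficients that depend on \<open>X\<close> and \<open>u\<close>
  alone.\<close>

lemma quad_form_series_kron:
  fixes X :: "('g :: finite) tuple"
  assumes F: "F \<in> carrier_mat m m" and ps: "has_nc_power_series m D F Fs \<epsilon>"
    and X: "X \<in> mat_tuples n" and A: "A \<in> carrier_mat M M" and "n \<ge> 1" "M \<ge> 1"
    and ball: "scale_tuple (complex_of_real s) (\<lambda>i. kron (X i) A) \<in> herm_ball (n * M) \<epsilon>"
  shows "(\<lambda>k. quad_form (m * n) (poly_eval n (Fs k) X) u * complex_of_real s ^ k * quad_form M (A ^\<^sub>m k) v) sums
    quad_form (m * n * M) (fun_eval (n * M) F (scale_tuple (complex_of_real s) (\<lambda>i. kron (X i) A)))
      (\<lambda>r. u (r div M) * v (r mod M))"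
proof -
  let ?Y = "scale_tuple (complex_of_real s) (\<lambda>i. kron (X i) A)"
  let ?v = "\<lambda>r. u (r div M) * v (r mod M)"
  have hom: "homogeneous_poly m k (Fs k)" for k using ps by (simp add: has_nc_power_series_def)
  have "n * M \<ge> 1" using \<open>n \<ge> 1\<close> \<open>M \<ge> 1\<close> by simp
  then have "mat_sums (\<lambda>k. poly_eval (n * M) (Fs k) ?Y) (fun_eval (n * M) F ?Y)"
    using ps ball unfolding has_nc_power_series_def by blast
  moreover have "fun_eval (n * M) F ?Y \<in> carrier_mat (m * n * M) (m * n * M)"
    using fun_eval_carrier[OF F, of "n * M"] by (simp add: mult.assoc)
  ultimately have "(\<lambda>k. quad_form (m * n * M) (poly_eval (n * M) (Fs k) ?Y) ?v) sums
      quad_form (m * n * M) (fun_eval (n * M) F ?Y) ?v"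
    by (rule quad_form_sums)
  moreover have "quad_form (m * n * M) (poly_eval (n * M) (Fs k) ?Y) ?v =
      quad_form (m * n) (poly_eval n (Fs k) X) u * complex_of_real s ^ k * quad_form M (A ^\<^sub>m k) v" for k
  proof -
    have P: "poly_eval n (Fs k) X \<in> carrier_mat (m * n) (m * n)"
      using hom[of k] by (intro poly_eval_carrier) (simp add: homogeneous_poly_def)
    have sA: "complex_of_real s \<cdot>\<^sub>m A \<in> carrier_mat M M" using A by simp
    have "poly_eval (n * M) (Fs k) ?Y = kron (poly_eval n (Fs k) X) ((complex_of_real s \<cdot>\<^sub>m A) ^\<^sub>m k)"
      unfolding scale_tuple_kron[OF X A] using poly_eval_kron[OF X sA _ hom] \<open>M \<ge> 1\<close> by simp
    then show ?thesis
      using quad_form_kron[OF P pow_carrier_mat[OF sA], of k u v] quad_form_smult[OF pow_carrier_mat[OF A]]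
      by (simp add: pow_mat_smult[OF A])
  qed
  ultimately show ?thesis by simp
qed

text \<open>The case of the 1 x 1 identity matrix, where the Kronecker product changes
  nothing.\<close>

lemma quad_form_series_line:
  fixes X :: "('g :: finite) tuple"
  assumes F: "F \<in> carrier_mat m m" and ps: "has_nc_power_series m D F Fs \<epsilon>"
    and X: "X \<in> mat_tuples n" and "n \<ge> 1" and ball: "scale_tuple (complex_of_real s) X \<in> herm_ball n \<epsilon>"
  shows "(\<lambda>k. quad_form (m * n) (poly_eval n (Fs k) X) u * complex_of_real s ^ k) sums
    quad_form (m * n) (fun_eval n F (scale_tuple (complex_of_real s) X)) u"
proof -
  have X1: "(\<lambda>i. kron (X i) (1\<^sub>m (Suc 0))) = X"
    using X kron_one_right by (auto simp: mat_tuples_def fun_eq_iff)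
  have pow1: "(1\<^sub>m 1 :: complex mat) ^\<^sub>m k = 1\<^sub>m (Suc 0)" for k by (induction k) auto
  have "quad_form 1 (1\<^sub>m 1) (\<lambda>_. 1) = 1" by (simp add: quad_form_def)
  then show ?thesis
    using quad_form_series_kron[OF F ps X, of "1\<^sub>m 1" 1 s u "\<lambda>_. 1"] \<open>n \<ge> 1\<close> ball
    by (simp add: X1 pow1[simplified])
qed

section \<open>Positivity of the Hankel form\<close>

definition convex_on_balls :: "('g :: finite) matfun \<Rightarrow> real \<Rightarrow> bool" where
  "convex_on_balls F \<epsilon> \<longleftrightarrow> (\<forall>n \<ge> 1. \<forall>X \<in> herm_ball n \<epsilon>. \<forall>Y \<in> herm_ball n \<epsilon>. \<forall>t \<in> {0..1}.
     loewner_le (fun_eval n F (tuple_convex_comb t X Y))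
       (complex_of_real t \<cdot>\<^sub>m fun_eval n F X + complex_of_real (1 - t) \<cdot>\<^sub>m fun_eval n F Y))"

text \<open>Midpoint convexity for \<open>X \<otimes> s J\<close> and its conjugate by the sign flip of node 0: the flip
  fixes the test vector, and the midpoint is the path with node 0 cut off.\<close>

lemma convex_path_inequality:
  fixes X :: "('g :: finite) tuple"
  assumes F: "F \<in> carrier_mat m m" and ps: "has_nc_power_series m D F Fs \<epsilon>" and "\<epsilon> > 0"
    and convex: "convex_on_balls F \<epsilon>'" and "\<epsilon>' > 0"
    and X: "X \<in> herm_tuples n" and n: "n \<ge> 1" and M: "M \<ge> 1"
  shows "\<exists>\<delta>>0. \<forall>s v. \<bar>s\<bar> < \<delta> \<longrightarrow> v 0 = 0 \<longrightarrow> (\<exists>r\<ge>0.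
    (\<lambda>k. quad_form (m * n) (poly_eval n (Fs k) X) u * complex_of_real s ^ k *
      (quad_form M (path_mat M 1 ^\<^sub>m k) v - quad_form M (path_mat M 0 ^\<^sub>m k) v)) sums complex_of_real r)"
proof -
  have Xm: "X \<in> mat_tuples n" using X by (simp add: herm_tuples_def)
  define a where "a k = quad_form (m * n) (poly_eval n (Fs k) X) u" for k
  define Y where "Y c s = scale_tuple (complex_of_real s) (\<lambda>i. kron (X i) (path_mat M c))" for c s
  have nM: "n * M \<ge> 1" using n M by simp
  \<comment> \<open>Series and convexity come with separate radii, hence the minimum. The bound on
    \<open>s\<close> may depend on \<open>X\<close>, \<open>M\<close> and \<open>c\<close>, because
    only the limit at 0 is taken later.\<close>
  have "\<exists>\<delta>>0. \<forall>s. \<bar>s\<bar> < \<delta> \<longrightarrow> Y c s \<in> herm_ball (n * M) (min \<epsilon> \<epsilon>')" for c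
    unfolding Y_def using \<open>\<epsilon> > 0\<close> \<open>\<epsilon>' > 0\<close>
    by (intro scale_tuple_in_herm_ball[OF nM] kron_herm_tuples[OF X path_mat_carrier path_mat_hermitian]) auto
  then obtain \<delta> where \<delta>: "\<And>c. \<delta> c > 0" "\<And>c s. \<bar>s\<bar> < \<delta> c \<Longrightarrow> Y c s \<in> herm_ball (n * M) (min \<epsilon> \<epsilon>')"
    by metis
  show ?thesis unfolding a_def[symmetric]
  proof (rule exI[of _ "min (\<delta> 0) (min (\<delta> 1) (\<delta> (- 1)))"], intro conjI allI impI)
    show "0 < min (\<delta> 0) (min (\<delta> 1) (\<delta> (- 1)))" using \<delta>(1) by simp
    fix s and v :: "nat \<Rightarrow> complex"
    assume s: "\<bar>s\<bar> < min (\<delta> 0) (min (\<delta> 1) (\<delta> (- 1)))" and v: "v 0 = 0"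
    define q where "q c k = quad_form M (path_mat M c ^\<^sub>m k) v" for c k
    define G where "G c = fun_eval (n * M) F (Y c s)" for c
    let ?w = "\<lambda>r. u (r div M) * v (r mod M)"
    let ?N = "m * n * M"
    have G: "G c \<in> carrier_mat ?N ?N" for c
      using fun_eval_carrier[OF F, of "n * M"] by (simp add: G_def mult.assoc)
    have ball: "Y c s \<in> herm_ball (n * M) \<epsilon>" "Y c s \<in> herm_ball (n * M) \<epsilon>'" if "c \<in> {0, 1, - 1}" for c
    proof -
      have "Y c s \<in> herm_ball (n * M) (min \<epsilon> \<epsilon>')" using \<delta>(2)[of s c] s that by auto
      then show "Y c s \<in> herm_ball (n * M) \<epsilon>" "Y c s \<in> herm_ball (n * M) \<epsilon>'"
        by (auto simp: herm_ball_def)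
    qed
    have sums: "(\<lambda>k. a k * complex_of_real s ^ k * q c k) sums quad_form ?N (G c) ?w" if "c \<in> {0, 1, - 1}" for c
      unfolding a_def q_def G_def Y_def using ball(1)[OF that] n M
      by (intro quad_form_series_kron[OF F ps Xm path_mat_carrier]) (auto simp: Y_def)
    have flip: "q (- 1) k = q 1 k" for k unfolding q_def by (rule quad_form_path_mat_pow_flip[of v M 1 k, OF v])
    have mid: "tuple_convex_comb (1 / 2) (Y 1 s) (Y (- 1) s) = Y 0 s"
      using Xm by (auto simp: tuple_convex_comb_def Y_def scale_tuple_def kron_def path_mat_def fun_eq_iff
          mat_tuples_def carrier_matD[of "X _" n n] mod_less_of_less_mult field_simps intro!: eq_matI)
    let ?E = "complex_of_real (1 / 2) \<cdot>\<^sub>m G 1 + complex_of_real (1 - 1 / 2) \<cdot>\<^sub>m G (- 1)"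
    have "loewner_le (fun_eval (n * M) F (tuple_convex_comb (1 / 2) (Y 1 s) (Y (- 1) s))) ?E"
      unfolding G_def
      by (rule convex[unfolded convex_on_balls_def, rule_format, OF nM]) (use ball in auto)
    then have psd: "psd (?E - G 0)" unfolding mid loewner_le_def G_def .
    have E: "?E \<in> carrier_mat ?N ?N" using G by simp
    obtain r where r: "r \<ge> 0" "quad_form ?N (?E - G 0) ?w = complex_of_real r"
      using psd psd_iff_quad_form[of "?E - G 0" ?N] minus_carrier_mat[OF G] by metis
    have split: "quad_form ?N (?E - G 0) ?w = complex_of_real (1 / 2) * quad_form ?N (G 1) ?w +
        complex_of_real (1 - 1 / 2) * quad_form ?N (G (- 1)) ?w - quad_form ?N (G 0) ?w"
      unfolding quad_form_minus[OF E G] quad_form_add[OF smult_carrier_mat[OF G] smult_carrier_mat[OF G]]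
        quad_form_smult[OF G] ..
    have "(\<lambda>k. complex_of_real (1 / 2) * (a k * complex_of_real s ^ k * q 1 k) +
        complex_of_real (1 - 1 / 2) * (a k * complex_of_real s ^ k * q (- 1) k) -
        a k * complex_of_real s ^ k * q 0 k) sums quad_form ?N (?E - G 0) ?w"
      unfolding split by (intro sums_diff sums_add sums_mult sums) auto
    moreover have "complex_of_real (1 / 2) * (a k * complex_of_real s ^ k * q 1 k) +
        complex_of_real (1 - 1 / 2) * (a k * complex_of_real s ^ k * q (- 1) k) -
        a k * complex_of_real s ^ k * q 0 k = a k * complex_of_real s ^ k * (q 1 k - q 0 k)" for k
      by (simp add: flip field_simps)
    ultimately have "(\<lambda>k. a k * complex_of_real s ^ k * (q 1 k - q 0 k)) sums complex_of_real r"
      by (simp only: r(2))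
    with r(1) show "\<exists>r\<ge>0. (\<lambda>k. a k * complex_of_real s ^ k * (quad_form M (path_mat M 1 ^\<^sub>m k) v -
        quad_form M (path_mat M 0 ^\<^sub>m k) v)) sums complex_of_real r"
      unfolding q_def by blast
  qed
qed

text \<open>Test vectors scaled like \<open>s ^ - i\<close> at node \<open>i + 1\<close> isolate, as \<open>s \<longrightarrow> 0\<close>, the coefficients of
  degree \<open>i + j + 2\<close> in \<open>convex_path_inequality\<close>.\<close>

lemma convex_imp_hankel_psd:
  fixes X :: "('g :: finite) tuple" and u :: "nat \<Rightarrow> complex" and x y :: real
  assumes F: "F \<in> carrier_mat m m" and ps: "has_nc_power_series m D F Fs \<epsilon>" and "\<epsilon> > 0"
    and convex: "convex_on_balls F \<epsilon>'" and "\<epsilon>' > 0"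
    and X: "X \<in> herm_tuples n" and n: "n \<ge> 1"
  defines "a \<equiv> \<lambda>k. quad_form (m * n) (poly_eval n (Fs k) X) u"
  shows "of_real (x\<^sup>2) * a (2 * i + 2) + of_real (2 * x * y) * a (i + j + 2) + of_real (y\<^sup>2) * a (2 * j + 2)
    \<in> \<real>\<^sub>\<ge>\<^sub>0"
proof -
  \<comment> \<open>Large enough for the nodes \<open>i + 1\<close> and \<open>j + 1\<close>; the
    sum avoids a maximum.\<close>
  define M where "M = i + j + 3"
  have M: "M \<ge> 1" "Suc i < M" "Suc j < M" by (auto simp: M_def)
  \<comment> \<open>Test vectors vanish at node 0, so index \<open>p\<close> stands for node
    \<open>p + 1\<close>. The number \<open>W p q k\<close> counts the walks of length
    \<open>k\<close> between the two nodes that visit node 0.\<close>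
  define W where "W p q k = (path_mat M 1 ^\<^sub>m k) $$ (Suc p, Suc q) - (path_mat M 0 ^\<^sub>m k) $$ (Suc p, Suc q)" for p q k
  have W: "W p q k = 0" if "k < p + q + 2" "Suc p < M" "Suc q < M" for p q k
    using path_mat_pow_diff[of "Suc p" M "Suc q" k] that by (simp add: W_def)
  have W_diag: "W p q (p + q + 2) = 1" if "Suc p < M" "Suc q < M" for p q
    using path_mat_pow_diff[of "Suc p" M "Suc q" "p + q + 2"] that by (simp add: W_def)
  have bound: "cmod (W p q k) \<le> 2 * 2 ^ k" if "Suc p < M" "Suc q < M" for p q k
    using norm_triangle_le_diff[OF add_mono[OF path_mat_pow_bound[of 1 "Suc p" M "Suc q" k]
      path_mat_pow_bound[of 0 "Suc p" M "Suc q" k]]] that by (simp add: W_def)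
  obtain \<delta>1 where \<delta>1: "\<delta>1 > 0" "\<And>t. \<bar>t\<bar> < \<delta>1 \<Longrightarrow> scale_tuple (complex_of_real t) X \<in> herm_ball n \<epsilon>"
    using scale_tuple_in_herm_ball[OF n X \<open>\<epsilon> > 0\<close>] by blast
  define t where "t = \<delta>1 / 2"
  have "t > 0" "\<bar>t\<bar> < \<delta>1" using \<delta>1(1) by (auto simp: t_def)
  have summ: "summable (\<lambda>k. a k * complex_of_real t ^ k)"
    using quad_form_series_line[OF F ps _ n \<delta>1(2)[OF \<open>\<bar>t\<bar> < \<delta>1\<close>]] X
    by (auto simp: a_def herm_tuples_def sums_iff)
  obtain \<delta> where "\<delta> > 0" and \<delta>: "\<And>s v. \<bar>s\<bar> < \<delta> \<Longrightarrow> v 0 = 0 \<Longrightarrow> \<exists>r\<ge>0.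
    (\<lambda>k. a k * complex_of_real s ^ k *
      (quad_form M (path_mat M 1 ^\<^sub>m k) v - quad_form M (path_mat M 0 ^\<^sub>m k) v)) sums complex_of_real r"
    using convex_path_inequality[OF F ps \<open>\<epsilon> > 0\<close> convex \<open>\<epsilon>' > 0\<close> X n M(1)] unfolding a_def by blast
  define f where "f p q s = suminf (\<lambda>k. a k * complex_of_real s ^ k * W p q k)" for p q s
  \<comment> \<open>The radius is \<open>t / 2\<close> because \<open>W\<close> may grow like
    \<open>2 ^ k\<close>.\<close>
  have small: "eventually (\<lambda>s. 0 < s \<and> s < min \<delta> (t / 2)) (at_right 0)"
    using \<open>t > 0\<close> \<open>\<delta> > 0\<close> by (auto simp: eventually_at_right_field intro!: exI[of _ "min \<delta> (t / 2)"])
  have f_sums: "(\<lambda>k. a k * complex_of_real s ^ k * W p q k) sums f p q s"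
    if "\<bar>s\<bar> < t / 2" "Suc p < M" "Suc q < M" for p q s
    unfolding f_def using that \<open>t > 0\<close>
    by (intro summable_sums summable_mult_geometric_bound[OF \<open>t > 0\<close> summ bound]) auto
  have lim: "((\<lambda>s. f p q s / of_real s ^ (p + q + 2)) \<longlongrightarrow> a (p + q + 2)) (at_right 0)"
    if "Suc p < M" "Suc q < M" for p q
  proof -
    have "((\<lambda>s. f p q s / of_real s ^ (p + q + 2)) \<longlongrightarrow> a (p + q + 2) * W p q (p + q + 2)) (at_right 0)"
      using small by (intro power_series_leading_coeff[OF \<open>t > 0\<close> summ W bound])
        (auto simp: that elim!: eventually_mono intro!: f_sums)
    then show ?thesis unfolding W_diag[OF that] by simp
  qed
  \<comment> \<open>The form at the scaled test vector, divided by \<open>s\<^sup>2\<close>: the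
    weights \<open>s ^ - i\<close> and \<open>s ^ - j\<close> then produce exactly the normalisation
    in \<open>lim\<close>.\<close>
  define S where "S s = of_real (x\<^sup>2) * (f i i s / of_real s ^ (i + i + 2)) +
      of_real (x * y) * (f i j s / of_real s ^ (i + j + 2)) +
      of_real (x * y) * (f j i s / of_real s ^ (j + i + 2)) +
      of_real (y\<^sup>2) * (f j j s / of_real s ^ (j + j + 2))" for s :: real
  have "(S \<longlongrightarrow> of_real (x\<^sup>2) * a (i + i + 2) + of_real (x * y) * a (i + j + 2) + of_real (x * y) * a (j + i + 2) +
      of_real (y\<^sup>2) * a (j + j + 2)) (at_right 0)"
    unfolding S_def by (intro tendsto_add tendsto_mult tendsto_const lim M)
  moreover have "eventually (\<lambda>s. S s \<in> \<real>\<^sub>\<ge>\<^sub>0) (at_right 0)"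
    using small
  proof eventually_elim
    case (elim s)
    then have s: "0 < s" "\<bar>s\<bar> < \<delta>" "\<bar>s\<bar> < t / 2" by auto
    define X' where "X' = complex_of_real (x / s ^ i)"
    define Y' where "Y' = complex_of_real (y / s ^ j)"
    let ?v = "\<lambda>r. (if r = Suc i then X' else 0) + (if r = Suc j then Y' else 0)"
    obtain r where r: "r \<ge> 0" "(\<lambda>k. a k * complex_of_real s ^ k *
      (quad_form M (path_mat M 1 ^\<^sub>m k) ?v - quad_form M (path_mat M 0 ^\<^sub>m k) ?v)) sums complex_of_real r"
      using \<delta>[OF s(2), of ?v] by auto
    have "quad_form M (path_mat M 1 ^\<^sub>m k) ?v - quad_form M (path_mat M 0 ^\<^sub>m k) ?v =
        X' * X' * W i i k + X' * Y' * W i j k + X' * Y' * W j i k + Y' * Y' * W j j k" for k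
      unfolding quad_form_two_points[OF M(2,3)] by (simp add: W_def X'_def Y'_def algebra_simps)
    then have "(\<lambda>k. X' * X' * (a k * of_real s ^ k * W i i k) + X' * Y' * (a k * of_real s ^ k * W i j k) +
        X' * Y' * (a k * of_real s ^ k * W j i k) + Y' * Y' * (a k * of_real s ^ k * W j j k)) sums complex_of_real r"
      using r(2) by (simp add: algebra_simps)
    moreover have "(\<lambda>k. X' * X' * (a k * of_real s ^ k * W i i k) + X' * Y' * (a k * of_real s ^ k * W i j k) +
        X' * Y' * (a k * of_real s ^ k * W j i k) + Y' * Y' * (a k * of_real s ^ k * W j j k)) sums
        (X' * X' * f i i s + X' * Y' * f i j s + X' * Y' * f j i s + Y' * Y' * f j j s)"
      by (intro sums_add sums_mult f_sums s(3) M)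
    ultimately have "X' * X' * f i i s + X' * Y' * f i j s + X' * Y' * f j i s + Y' * Y' * f j j s = complex_of_real r"
      by (rule sums_unique2[symmetric])
    moreover have "S s = (X' * X' * f i i s + X' * Y' * f i j s + X' * Y' * f j i s + Y' * Y' * f j j s) / of_real (s\<^sup>2)"
      using s(1) by (simp add: S_def X'_def Y'_def power_add power2_eq_square field_simps)
    ultimately have "S s = complex_of_real (r / s\<^sup>2)" by simp
    then show ?case using r(1) by (simp only: nonneg_Reals_of_real_iff) simp
  qed
  ultimately have "of_real (x\<^sup>2) * a (i + i + 2) + of_real (x * y) * a (i + j + 2) + of_real (x * y) * a (j + i + 2) +
      of_real (y\<^sup>2) * a (j + j + 2) \<in> \<real>\<^sub>\<ge>\<^sub>0"
    by (rule Lim_in_closed_set[OF closed_nonneg_Reals_complex, rotated 2]) simp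
  moreover have "of_real (2 * x * y) * a (i + j + 2) =
      of_real (x * y) * a (i + j + 2) + of_real (x * y) * a (j + i + 2)"
    by (simp only: add.commute[of j i] of_real_add mult_2 distrib_right)
  ultimately show ?thesis by (simp only: mult_2 add.assoc)
qed

section \<open>From the scalar statements back to the matrix identity\<close>

theorem corollary1p5:
  fixes m :: nat
    and D :: "('g :: finite) tuple set"
    and F Fc :: "'g matfun"
    and Fs :: "nat \<Rightarrow> 'g ncpoly mat"
  assumes "nc_set D"
    and "matrix_nc_function m D F"
    and "hermitian_nc_function m D F Fs"
    and "matrix_convex_near_origin m D F Fs"
    and "real_entire_near_origin m D F Fs Fc"
  shows "(\<forall>k \<le> 2. homogeneous_poly m k (Fs k)) \<and>
    (\<forall>n \<ge> 1. \<forall>X \<in> herm_tuples n.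
       fun_eval n Fc X = poly_eval n (Fs 0) X + poly_eval n (Fs 1) X + poly_eval n (Fs 2) X)"
proof (intro conjI allI impI ballI)
  have F: "F \<in> carrier_mat m m" using assms(2) by (simp add: matrix_nc_function_def)
  have Fc: "Fc \<in> carrier_mat m m" using assms(5) by (simp add: real_entire_near_origin_def)
  \<comment> \<open>Of the radii in the hypotheses this is the one on which \<open>Fc\<close> agrees
    with \<open>F\<close>.\<close>
  obtain \<epsilon> where "\<epsilon> > 0" and ps: "has_nc_power_series m D F Fs \<epsilon>"
    and cont: "\<And>n. n \<ge> 1 \<Longrightarrow> \<exists>U. open_tuples n U \<and> herm_tuples n \<subseteq> U \<and>
          (\<forall>i<m. \<forall>j<m. mat_analytic_on n (Fc $$ (i, j)) U) \<and>
          (\<forall>X \<in> herm_ball n \<epsilon>. fun_eval n Fc X = fun_eval n F X)"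
    using assms(5) unfolding real_entire_near_origin_def by blast
  obtain \<epsilon>' where "\<epsilon>' > 0" and convex: "convex_on_balls F \<epsilon>'"
    using assms(4) unfolding matrix_convex_near_origin_def convex_on_balls_def by blast
  have hom: "homogeneous_poly m k (Fs k)" for k using ps by (simp add: has_nc_power_series_def)
  then show "homogeneous_poly m k (Fs k)" for k .
  fix n :: nat and X :: "'g tuple" assume n: "n \<ge> 1" and X: "X \<in> herm_tuples n"
  have Xm: "X \<in> mat_tuples n" using X by (simp add: herm_tuples_def)
  obtain U where U: "open_tuples n U" "herm_tuples n \<subseteq> U"
    "\<And>i j. i < m \<Longrightarrow> j < m \<Longrightarrow> mat_analytic_on n (Fc $$ (i, j)) U"
    "\<And>X. X \<in> herm_ball n \<epsilon> \<Longrightarrow> fun_eval n Fc X = fun_eval n F X"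
    using cont[OF n] by blast
  obtain \<delta> where "\<delta> > 0" and \<delta>: "\<And>t. \<bar>t\<bar> < \<delta> \<Longrightarrow> scale_tuple (complex_of_real t) X \<in> herm_ball n \<epsilon>"
    using scale_tuple_in_herm_ball[OF n X \<open>\<epsilon> > 0\<close>] by blast
  \<comment> \<open>The part of the complex line through \<open>X\<close> that the continuation
    reaches; it contains the real axis because real multiples of \<open>X\<close> are
    Hermitian.\<close>
  define V where "V = {z. scale_tuple z X \<in> U}"
  have "open V"
    unfolding open_dist
  proof
    fix z assume "z \<in> V"
    then obtain r where "r > 0" "polydisc n (scale_tuple z X) r \<subseteq> U"
      using U(1) by (auto simp: V_def open_tuples_def)
    with scale_tuple_in_polydisc[OF Xm \<open>r > 0\<close>, of z]
    show "\<exists>e>0. \<forall>w. dist w z < e \<longrightarrow> w \<in> V" by (auto simp: V_def dist_norm)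
  qed
  have real_V: "complex_of_real t \<in> V" for t
    using U(2) scale_tuple_herm_tuples[OF X] by (auto simp: V_def)
  let ?N = "m * n"
  have P: "poly_eval n (Fs k) X \<in> carrier_mat ?N ?N" for k
    using hom[of k] by (intro poly_eval_carrier) (simp add: homogeneous_poly_def)
  have entry: "(\<lambda>z. fun_eval n Fc (scale_tuple z X) $$ (r, s)) holomorphic_on V" if rs: "r < ?N" "s < ?N" for r s
  proof -
    have d: "r div n < m" "s div n < m" "r mod n < n" "s mod n < n"
      using rs by (auto intro: less_mult_imp_div_less mod_less_of_less_mult)
    have "(\<lambda>z. (Fc $$ (r div n, s div n)) (scale_tuple z X) $$ (r mod n, s mod n)) field_differentiable (at z)"
      if "z \<in> V" for z
    proof (rule analytic_at_line[OF _ Xm, where f = "\<lambda>W. (Fc $$ (r div n, s div n)) W $$ (r mod n, s mod n)"])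
      show "analytic_at n (\<lambda>W. (Fc $$ (r div n, s div n)) W $$ (r mod n, s mod n)) (scale_tuple z X)"
        using U(3)[OF d(1,2)] d(3,4) that by (simp add: mat_analytic_on_def V_def)
    qed
    moreover have "fun_eval n Fc W $$ (r, s) = (Fc $$ (r div n, s div n)) W $$ (r mod n, s mod n)" for W
      using rs d Fc by (auto simp: fun_eval_def block_mat_def)
    ultimately show ?thesis
      by (auto simp: holomorphic_on_def intro: field_differentiable_at_within)
  qed
  let ?E = "poly_eval n (Fs 0) X + poly_eval n (Fs 1) X + poly_eval n (Fs 2) X"
  \<comment> \<open>For fixed \<open>u\<close> the claim is scalar and concerns the line at
    parameter 1; polarisation recovers the entries afterwards.\<close>
  have quad: "quad_form ?N (fun_eval n Fc X - ?E) u = 0" for u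
  proof -
    define h where "h z = quad_form ?N (fun_eval n Fc (scale_tuple z X)) u" for z
    define a where "a k = quad_form ?N (poly_eval n (Fs k) X) u" for k
    have "h (of_real 1) = a 0 + a 1 * of_real 1 + a 2 * (of_real 1)\<^sup>2"
    proof (rule hankel_psd_real_entire_imp_quadratic[OF \<open>open V\<close> real_V _ \<open>\<delta> > 0\<close>])
      show "h holomorphic_on V"
        unfolding h_def quad_form_def by (intro holomorphic_intros entry) auto
      show "(\<lambda>k. a k * of_real t ^ k) sums h (of_real t)" if "\<bar>t\<bar> < \<delta>" for t
        using quad_form_series_line[OF F ps Xm n \<delta>[OF that]] U(4)[OF \<delta>[OF that]] by (simp add: h_def a_def)
      show "\<exists>r\<ge>0. of_real (x\<^sup>2) * a (2 * i + 2) + of_real (2 * x * y) * a (i + j + 2) +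
          of_real (y\<^sup>2) * a (2 * j + 2) = complex_of_real r" for i j x y
        using convex_imp_hankel_psd[OF F ps \<open>\<epsilon> > 0\<close> convex \<open>\<epsilon>' > 0\<close> X n, of x i u y j] unfolding a_def
        by (elim nonneg_Reals_cases) blast
    qed
    moreover have "scale_tuple 1 X = X"
      by (auto simp: scale_tuple_def fun_eq_iff intro!: eq_matI)
    ultimately have "quad_form ?N (fun_eval n Fc X) u = a 0 + a 1 + a 2" by (simp add: h_def)
    moreover have "quad_form ?N (fun_eval n Fc X - ?E) u = quad_form ?N (fun_eval n Fc X) u - (a 0 + a 1 + a 2)"
      unfolding a_def quad_form_minus[OF fun_eval_carrier[OF Fc] add_carrier_mat[OF P]]
        quad_form_add[OF add_carrier_mat[OF P] P] quad_form_add[OF P P] ..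
    ultimately show ?thesis by simp
  qed
  show "fun_eval n Fc X = ?E"
  proof (rule eq_matI)
    fix r s assume "r < dim_row ?E" "s < dim_col ?E"
    then have rs: "r < ?N" "s < ?N" using carrier_matD[OF P] by auto
    have "(fun_eval n Fc X - ?E) $$ (r, s) = 0" by (rule quad_form_zero_imp_zero[OF quad rs])
    then show "fun_eval n Fc X $$ (r, s) = ?E $$ (r, s)"
      using rs P carrier_matD[OF P] by (simp add: carrier_matD[OF fun_eval_carrier[OF Fc]])
  qed (simp_all add: carrier_matD[OF fun_eval_carrier[OF Fc]] carrier_matD[OF P])
qed

end
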